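(* Let $V$ be a grading-restricted vertex algebra freely generated by a finite set $S=\{a^{(1)},\dots,a^{(r)}\}$ of homogeneous elements of positive weights, and let $Y_1:V\otimes V\to V((x))$ be a cocycle such that for all $n\ge1$ and $s^{(1)},\dots,s^{(n+1)}\in S$ the $\overline V$-valued rational function $$E\Big(Y_1(s^{(1)},z_1)Y(s^{(2)},z_2)\cdots Y(s^{(n)},z_n)s^{(n+1)}\Big)\qquad( * )$$ is well defined. Then for all $1\le i_1\le\cdots\le i_p\le r$, $1\le j_1\le\cdots\le j_q\le r$ and $m_1,\dots,m_p,n_1,\dots,n_q\in\mathbb Z_+$ with $m_k\ge\cdots\ge m_{k+l}$ whenever $i_{k-1}<i_k=\cdots=i_{k+l}<i_{k+l+1}$ and $n_k\ge\cdots\ge n_{k+l}$ whenever $j_{k-1}<j_k=\cdots=j_{k+l}<j_{k+l+1}$, the series $$Y_1\big(a^{(i_1)}_{-m_1}\cdots a^{(i_p)}_{-m_p}\mathbf 1,x\big)a^{(j_1)}_{-n_1}\cdots a^{(j_q)}_{-n_q}\mathbf 1$$ is uniquely determined by the functions $( * )$ (for all $n$ and all $s^{(1)},\dots,s^{(n+1)}\in S$); that is, two such cocycles with the same functions $( * )$ coincide on these elements.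
   Context: All vector spaces are over $\mathbb C$. A grading-restricted vertex algebra is a vertex algebra $(V,Y,\mathbf 1)$, $Y(u,x)v=\sum_{n\in\mathbb Z}u_nv\,x^{-n-1}$, with a grading $V=\coprod_{n\in\mathbb Z}V_{(n)}$ (by weights), $V_{(n)}=0$ for $n$ sufficiently negative, such that $\mathrm{wt}(u_nv)=\mathrm{wt}\,u+\mathrm{wt}\,v-n-1$. $Dv=v_{-2}\mathbf 1$; $V'=\coprod V_{(n)}^*$; $\overline V=\prod V_{(n)}$. $S=\{a^{(1)},\dots,a^{(r)}\}$ freely generates $V$ if the vectors $a^{(1)}_{-m^{(1)}_1}\cdots a^{(1)}_{-m^{(1)}_{k_1}}\cdots a^{(r)}_{-m^{(r)}_1}\cdots a^{(r)}_{-m^{(r)}_{k_r}}\mathbf 1$ with $k_i\ge0$ and $m^{(i)}_1\ge\cdots\ge m^{(i)}_{k_i}\ge1$ form a basis of $V$. Cocycles: linear maps $Y_1:V\otimes V\to V((x))$, $Y_1(u,x)v=\sum_n u^{def}_nv\,x^{-n-1}$, such that (1) $\mathrm{wt}(u^{def}_nv)=\mathrm{wt}\,u+\mathrm{wt}\,v-n-1$; (2) $Y_1(\mathbf 1,x)v=0$; (3) $Y_1(u,x)\mathbf 1=0$; (4) $[D,Y_1(u,x)]=Y_1(Du,x)=\frac{d}{dx}Y_1(u,x)$; (5) for $v'\in V'$, $u_1,u_2,v\in V$, the series $\langle v',Y_1(u_1,z_1)Y(u_2,z_2)v\rangle+\langle v',Y(u_1,z_1)Y_1(u_2,z_2)v\rangle$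 and $\langle v',Y_1(Y(u_1,z_1-z_2)u_2,z_2)v\rangle+\langle v',Y(Y_1(u_1,z_1-z_2)u_2,z_2)v\rangle$ (only the sums) converge absolutely in $|z_1|>|z_2|>0$, resp. $|z_2|>|z_1-z_2|>0$, to a common rational function with only possible poles at $z_1=0,z_2=0,z_1=z_2$; (6) $Y_1(u,x)v=e^{xD}Y_1(v,-x)u$. $E(f(z_1,\dots,z_n))$, for a series $f$ with coefficients in $V$, is well defined if for every $v'\in V'$ the series $\langle v',f\rangle$ converges absolutely (for products, in $|z_1|>\cdots>|z_n|>0$) to a rational function with only possible poles at $z_i=0$ and $z_i=z_j$; $E(f)$ is then the resulting $\overline V$-valued rational function on $\{z_i\ne0,\ z_i\ne z_j\}$. *)

theory Defs
  imports
    "HOL-Analysis.Infinite_Sum"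
    "HOL-Computational_Algebra.Formal_Laurent_Series"
    "HOL-Library.Groups_Big_Fun"
begin

section \<open>Grading-restricted vertex algebras\<close>

text \<open>
  A linear map \<open>Y : V \<otimes> V \<rightarrow> V((x))\<close> is a function \<open>Y :: 'v \<Rightarrow> 'v \<Rightarrow> 'v fls\<close> that is bilinear
  coefficient by coefficient; \<open>Y u v\<close> is the series \<open>Y(u,x)v = (\<Sum>n. u\<^sub>n v x\<^bsup>-n-1\<^esup>)\<close>.
  \<^const>\<open>Sum_any\<close> sums a family with finite support. All its uses on algebra-valued families
  below have finite support because Laurent series are bounded below.
\<close>

definition mode :: "('v \<Rightarrow> 'v \<Rightarrow> 'v::zero fls) \<Rightarrow> 'v \<Rightarrow> int \<Rightarrow> 'v \<Rightarrow> 'v" where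
  "mode Y u n v = fls_nth (Y u v) (- n - 1)"

definition bilinear_series ::
  "(complex \<Rightarrow> 'v::ab_group_add \<Rightarrow> 'v) \<Rightarrow> ('v \<Rightarrow> 'v \<Rightarrow> 'v fls) \<Rightarrow> bool" where
  "bilinear_series smul Y \<longleftrightarrow>
     (\<forall>v k. Vector_Spaces.linear smul smul (\<lambda>u. fls_nth (Y u v) k)) \<and>
     (\<forall>u k. Vector_Spaces.linear smul smul (\<lambda>v. fls_nth (Y u v) k))"

definition translation_op :: "('v \<Rightarrow> 'v \<Rightarrow> 'v::zero fls) \<Rightarrow> 'v \<Rightarrow> 'v \<Rightarrow> 'v" where
  "translation_op Y vac v = mode Y v (-2) vac"

text \<open>The Jacobi identity is stated in components (the Borcherds identity): it is the
  coefficient of \<open>x\<^sub>0\<^bsup>-l-1\<^esup> x\<^sub>1\<^bsup>-m-1\<^esup> x\<^sub>2\<^bsup>-n-1\<^esup>\<close> applied to \<open>w\<close>.\<close>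

locale vertex_algebra = vector_space smul
  for smul :: "complex \<Rightarrow> 'v::ab_group_add \<Rightarrow> 'v" +
  fixes Y :: "'v \<Rightarrow> 'v \<Rightarrow> 'v fls"
    and vac :: 'v
  assumes Y_bilinear: "bilinear_series smul Y"
    and identity: "Y vac v = fls_const v"
    and creation_regular: "k < 0 \<Longrightarrow> fls_nth (Y u vac) k = 0"
    and creation_limit: "fls_nth (Y u vac) 0 = u"
    and jacobi:
      "Sum_any (\<lambda>i::nat. smul ((-1) ^ i * (of_int l gchoose i))
           (mode Y u (m + l - int i) (mode Y v (n + int i) w)
            - smul ((-1) powi l) (mode Y v (n + l - int i) (mode Y u (m + int i) w))))
       = Sum_any (\<lambda>i::nat. smul (of_int m gchoose i)
           (mode Y (mode Y u (l + int i) v) (m + n - int i) w))"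

text \<open>\<open>V n\<close> is the homogeneous subspace of weight \<open>n\<close>.\<close>

locale grading_restricted_vertex_algebra = vertex_algebra smul Y vac
  for smul :: "complex \<Rightarrow> 'v::ab_group_add \<Rightarrow> 'v"
    and Y :: "'v \<Rightarrow> 'v \<Rightarrow> 'v fls"
    and vac :: 'v +
  fixes V :: "int \<Rightarrow> 'v set"
  assumes homogeneous_subspace: "subspace (V n)"
    and direct_sum:
      "\<exists>!w. (\<forall>n. w n \<in> V n) \<and> finite {n. w n \<noteq> 0} \<and> v = Sum_any w"
    and lower_bounded: "\<exists>N. \<forall>n<N. V n = {0}"
    and weight_mode: "u \<in> V k \<Longrightarrow> v \<in> V l \<Longrightarrow> mode Y u n v \<in> V (k + l - n - 1)"

definition graded_dual ::
  "(complex \<Rightarrow> 'v::ab_group_add \<Rightarrow> 'v) \<Rightarrow> (int \<Rightarrow> 'v set) \<Rightarrow> ('v \<Rightarrow> complex) set" where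
  "graded_dual smul V =
     {\<phi>. Vector_Spaces.linear smul (*) \<phi> \<and> finite {n. \<exists>v\<in>V n. \<phi> v \<noteq> 0}}"

definition graded_completion :: "(int \<Rightarrow> 'v set) \<Rightarrow> (int \<Rightarrow> 'v) set" where
  "graded_completion V = Pi UNIV V"

definition pairing :: "('v \<Rightarrow> complex) \<Rightarrow> (int \<Rightarrow> 'v) \<Rightarrow> complex" where
  "pairing \<phi> w = Sum_any (\<lambda>n. \<phi> (w n))"


section \<open>Free generation\<close>

text \<open>The word \<open>[(i\<^sub>1,m\<^sub>1),\<dots>,(i\<^sub>p,m\<^sub>p)]\<close> stands for \<open>a\<^bsup>(i\<^sub>1)\<^esup>\<^bsub>-m\<^sub>1\<^esub> \<cdots> a\<^bsup>(i\<^sub>p)\<^esup>\<^bsub>-m\<^sub>p\<^esub> vac\<close>. In an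
  ordered word the generator indices increase weakly and the modes decrease weakly within every
  block of equal indices, so ordered words enumerate, once each, the choices of the lengths
  \<open>k\<^sub>i \<ge> 0\<close> and sequences \<open>m\<^bsup>(i)\<^esup>\<^sub>1 \<ge> \<cdots> \<ge> m\<^bsup>(i)\<^esup>\<^bsub>k\<^sub>i\<^esub> \<ge> 1\<close> for \<open>i = 1, \<dots>, r\<close>.\<close>

definition ordered_word :: "nat \<Rightarrow> (nat \<times> nat) list \<Rightarrow> bool" where
  "ordered_word r w \<longleftrightarrow>
     (\<forall>(i, m) \<in> set w. i \<in> {1..r} \<and> m \<ge> 1) \<and>
     sorted_wrt (\<lambda>(i, m) (i', m'). i \<le> i' \<and> (i = i' \<longrightarrow> m \<ge> m')) w"

definition word_vector ::
  "('v \<Rightarrow> 'v \<Rightarrow> 'v::zero fls) \<Rightarrow> 'v \<Rightarrow> (nat \<Rightarrow> 'v) \<Rightarrow> (nat \<times> nat) list \<Rightarrow> 'v" where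
  "word_vector Y vac a w = foldr (\<lambda>(i, m) v. mode Y (a i) (- int m) v) w vac"

definition freely_generates ::
  "(complex \<Rightarrow> 'v::ab_group_add \<Rightarrow> 'v) \<Rightarrow> ('v \<Rightarrow> 'v \<Rightarrow> 'v fls) \<Rightarrow> 'v \<Rightarrow> (nat \<Rightarrow> 'v) \<Rightarrow> nat \<Rightarrow> bool"
  where
  "freely_generates smul Y vac a r \<longleftrightarrow>
     inj_on (word_vector Y vac a) {w. ordered_word r w} \<and>
     \<not> module.dependent smul (word_vector Y vac a ` {w. ordered_word r w}) \<and>
     module.span smul (word_vector Y vac a ` {w. ordered_word r w}) = UNIV"


section \<open>Series in several variables and rational functions\<close>

definition configurations :: "nat \<Rightarrow> complex list set" where
  "configurations n = {zs. length zs = n \<and> 0 \<notin> set zs \<and> distinct zs}"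

definition product_region :: "nat \<Rightarrow> complex list set" where
  "product_region n =
     {zs. length zs = n \<and> 0 \<notin> set zs \<and> sorted_wrt (\<lambda>z z'. cmod z > cmod z') zs}"

text \<open>Rational functions in \<open>n\<close> variables whose only possible poles are \<open>z\<^sub>i = 0\<close> and
  \<open>z\<^sub>i = z\<^sub>j\<close>: the numerator is a polynomial with exponent vectors in the finite set \<open>A\<close>. Values
  outside \<^const>\<open>configurations\<close> are irrelevant.\<close>

definition rational_on_configurations :: "nat \<Rightarrow> (complex list \<Rightarrow> complex) \<Rightarrow> bool" where
  "rational_on_configurations n R \<longleftrightarrow>
     (\<exists>A c N. finite A \<and> A \<subseteq> {\<alpha>. length \<alpha> = n} \<and>
       (\<forall>zs\<in>configurations n.
          R zs = (\<Sum>\<alpha>\<in>A. c \<alpha> * prod_list (map2 (^) zs \<alpha>)) /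
            (\<Prod>i<n. (zs ! i) ^ N * (\<Prod>j<i. (zs ! j - zs ! i) ^ N))))"

text \<open>A series in \<open>n\<close> variables with coefficients in \<open>V\<close> is the function sending an exponent vector
  \<open>ks\<close> of length \<open>n\<close> to the coefficient of \<open>z\<^sub>1\<^bsup>k\<^sub>1\<^esup> \<cdots> z\<^sub>n\<^bsup>k\<^sub>n\<^esup>\<close>.
  The following says that \<open>\<langle>\<phi>, f\<rangle>\<close> converges absolutely at \<open>zs\<close>, with sum \<open>s\<close>.\<close>

definition converges_absolutely_to ::
  "nat \<Rightarrow> ('v \<Rightarrow> complex) \<Rightarrow> (int list \<Rightarrow> 'v) \<Rightarrow> complex list \<Rightarrow> complex \<Rightarrow> bool" where
  "converges_absolutely_to n \<phi> f zs s \<longleftrightarrow>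
     (\<lambda>ks. \<phi> (f ks) * prod_list (map2 (powi) zs ks)) abs_summable_on {ks. length ks = n} \<and>
     ((\<lambda>ks. \<phi> (f ks) * prod_list (map2 (powi) zs ks)) has_sum s) {ks. length ks = n}"

definition E_well_defined ::
  "(complex \<Rightarrow> 'v::ab_group_add \<Rightarrow> 'v) \<Rightarrow> (int \<Rightarrow> 'v set) \<Rightarrow> nat \<Rightarrow> (int list \<Rightarrow> 'v) \<Rightarrow> bool" where
  "E_well_defined smul V n f \<longleftrightarrow>
     (\<forall>\<phi>\<in>graded_dual smul V. \<exists>R. rational_on_configurations n R \<and>
        (\<forall>zs\<in>product_region n. converges_absolutely_to n \<phi> f zs (R zs)))"

text \<open>The function \<open>E(f)\<close> with values in \<^const>\<open>graded_completion\<close>. On \<^const>\<open>configurations\<close> it is unique,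
  because functionals in \<^const>\<open>graded_dual\<close> separate points and a rational function is determined by
  its values on \<^const>\<open>product_region\<close>; elsewhere its values are meaningless. When \<open>f\<close>
  satisfies \<^const>\<open>E_well_defined\<close> it exists as soon as all \<open>V n\<close> are finite-dimensional, as they
  are for an algebra freely generated by finitely many elements of positive weights.\<close>

definition E_fun ::
  "(complex \<Rightarrow> 'v::ab_group_add \<Rightarrow> 'v) \<Rightarrow> (int \<Rightarrow> 'v set) \<Rightarrow> nat \<Rightarrow> (int list \<Rightarrow> 'v) \<Rightarrow>
    complex list \<Rightarrow> (int \<Rightarrow> 'v)" where
  "E_fun smul V n f = (SOME F.
     (\<forall>zs\<in>configurations n. F zs \<in> graded_completion V) \<and>
     (\<forall>\<phi>\<in>graded_dual smul V.
        rational_on_configurations n (\<lambda>zs. pairing \<phi> (F zs)) \<and>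
        (\<forall>zs\<in>product_region n. converges_absolutely_to n \<phi> f zs (pairing \<phi> (F zs)))))"


section \<open>Cocycles\<close>

text \<open>The coefficient of \<open>x\<^bsup>k\<^esup>\<close> in \<open>e\<^bsup>xD\<^esup> Y\<^sub>1(v,-x)u\<close> is the right-hand side of \<open>skew_symmetry\<close>.
  In \<open>cocycle_duality\<close> the iterate is a series in \<open>z\<^sub>1 - z\<^sub>2\<close> and \<open>z\<^sub>2\<close>, and only the combined
  series, not its two summands, is required to converge.\<close>

locale cocycle = grading_restricted_vertex_algebra smul Y vac V
  for smul :: "complex \<Rightarrow> 'v::ab_group_add \<Rightarrow> 'v"
    and Y :: "'v \<Rightarrow> 'v \<Rightarrow> 'v fls"
    and vac :: 'v
    and V :: "int \<Rightarrow> 'v set" +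
  fixes Y1 :: "'v \<Rightarrow> 'v \<Rightarrow> 'v fls"
  assumes Y1_bilinear: "bilinear_series smul Y1"
    and weight_Y1: "u \<in> V k \<Longrightarrow> v \<in> V l \<Longrightarrow> mode Y1 u n v \<in> V (k + l - n - 1)"
    and Y1_vac_left: "Y1 vac v = 0"
    and Y1_vac_right: "Y1 u vac = 0"
    and D_commutator:
      "translation_op Y vac (fls_nth (Y1 u v) k) - fls_nth (Y1 u (translation_op Y vac v)) k
       = fls_nth (Y1 (translation_op Y vac u) v) k"
    and D_derivative:
      "fls_nth (Y1 (translation_op Y vac u) v) k = smul (of_int (k + 1)) (fls_nth (Y1 u v) (k + 1))"
    and cocycle_duality:
      "\<phi> \<in> graded_dual smul V \<Longrightarrow>
       \<exists>R. rational_on_configurations 2 R \<and>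
         (\<forall>z1 z2. cmod z1 > cmod z2 \<and> cmod z2 > 0 \<longrightarrow>
            converges_absolutely_to 2 \<phi>
              (\<lambda>ks. fls_nth (Y1 u1 (fls_nth (Y u2 v) (ks ! 1))) (ks ! 0)
                  + fls_nth (Y u1 (fls_nth (Y1 u2 v) (ks ! 1))) (ks ! 0))
              [z1, z2] (R [z1, z2])) \<and>
         (\<forall>z1 z2. cmod z2 > cmod (z1 - z2) \<and> cmod (z1 - z2) > 0 \<longrightarrow>
            converges_absolutely_to 2 \<phi>
              (\<lambda>ks. fls_nth (Y1 (fls_nth (Y u1 u2) (ks ! 0)) v) (ks ! 1)
                  + fls_nth (Y (fls_nth (Y1 u1 u2) (ks ! 0)) v) (ks ! 1))
              [z1 - z2, z2] (R [z1, z2]))"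
    and skew_symmetry:
      "fls_nth (Y1 u v) k =
       Sum_any (\<lambda>j::nat. smul ((-1) powi (k - int j) / fact j)
         ((translation_op Y vac ^^ j) (fls_nth (Y1 v u) (k - int j))))"

text \<open>Coefficients of \<open>Y(s\<^sub>2,z\<^sub>2) \<cdots> Y(s\<^sub>n,z\<^sub>n)t\<close> and of \<open>Y\<^sub>1(s\<^sub>1,z\<^sub>1)Y(s\<^sub>2,z\<^sub>2) \<cdots> Y(s\<^sub>n,z\<^sub>n)t\<close>, where
  \<open>ss = [s\<^sub>2,\<dots>,s\<^sub>n]\<close>.\<close>

definition product_coeff ::
  "('v \<Rightarrow> 'v \<Rightarrow> 'v::zero fls) \<Rightarrow> 'v list \<Rightarrow> 'v \<Rightarrow> int list \<Rightarrow> 'v" where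
  "product_coeff Y ss t ks = foldr (\<lambda>(s, k) v. fls_nth (Y s v) k) (zip ss ks) t"

definition cocycle_product ::
  "('v \<Rightarrow> 'v \<Rightarrow> 'v::zero fls) \<Rightarrow> ('v \<Rightarrow> 'v \<Rightarrow> 'v fls) \<Rightarrow> 'v \<Rightarrow> 'v list \<Rightarrow> 'v \<Rightarrow> int list \<Rightarrow> 'v" where
  "cocycle_product Y1 Y s1 ss t ks = fls_nth (Y1 s1 (product_coeff Y ss t (tl ks))) (hd ks)"

end

theory Submission imports Defs begin

text \<open>
  Since the algebra has a homogeneous basis with finitely many elements of each weight, the
  functions \<open>(*)\<close> determine all coefficients of the products
  \<open>Y\<^sub>1(s\<^sub>1,z\<^sub>1)Y(s\<^sub>2,z\<^sub>2) \<cdots> Y(s\<^sub>n,z\<^sub>n)t\<close> with entries in \<open>S\<close>. The vectors on which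
  \<open>Y\<^sub>1(s,x)\<close> is determined for all \<open>s \<in> S\<close> form a subspace that is stable under \<open>D\<close>, and every word
  ends in \<open>s\<^bsub>-m\<^esub> vac = D\<^bsup>m-1\<^esup> s / (m-1)!\<close>; moving \<open>D\<close> outwards through the other letters shows that this
  subspace contains all words. Finally, if \<open>Y\<^sub>1(u\<^sub>1,x)\<close> and \<open>Y\<^sub>1(u\<^sub>2,x)\<close> are determined, then
  so is the product side of the duality axiom, hence its rational function, hence the iterate side;
  there \<open>Y(Y\<^sub>1(u\<^sub>1,z\<^sub>1-z\<^sub>2)u\<^sub>2,z\<^sub>2)\<close> is known, which leaves \<open>Y\<^sub>1(Y(u\<^sub>1,z\<^sub>1-z\<^sub>2)u\<^sub>2,z\<^sub>2)\<close>. Induction on the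
  word in the first argument concludes.
\<close>

section \<open>Uniqueness of Laurent expansions on a torus\<close>

lemma has_sum_finite_sum:
  fixes f :: "'i \<Rightarrow> 'b \<Rightarrow> 'a::topological_comm_monoid_add"
  assumes "\<And>i. i \<in> I \<Longrightarrow> (f i has_sum s i) A"
  shows "((\<lambda>x. \<Sum>i\<in>I. f i x) has_sum (\<Sum>i\<in>I. s i)) A"
  using assms by (induction I rule: infinite_finite_induct) (auto intro: has_sum_add)

text \<open>Orthogonality of characters of the cyclic group of order \<open>M\<close>: the sum is
  geometric with ratio \<open>q\<close>, where \<open>q ^ M = 1\<close> and \<open>q = 1\<close>
  would force \<open>M\<close> to divide \<open>k\<close>. The three facts treat, in order, the
  coefficient to be isolated, the tail, and the finitely many nearby terms.\<close>

lemma cis_root_average: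
  fixes k :: int and M :: nat
  assumes "M > 0"
  defines "A \<equiv> (\<Sum>j<M. cis (2 * pi * real j / real M) powi k) / of_nat M"
  shows "k = 0 \<Longrightarrow> A = 1" and "cmod A \<le> 1" and "0 < \<bar>k\<bar> \<Longrightarrow> \<bar>k\<bar> < int M \<Longrightarrow> A = 0"
proof -
  show "A = 1" if "k = 0"
    using that assms by (simp add: A_def)
  have "cmod (\<Sum>j<M. cis (2 * pi * real j / real M) powi k)
      \<le> (\<Sum>j<M. cmod (cis (2 * pi * real j / real M) powi k))"
    by (rule norm_sum)
  also have "\<dots> = M"
    by (simp add: norm_power_int)
  finally show "cmod A \<le> 1"
    using assms by (simp add: A_def norm_divide)
  define q where "q = cis (2 * pi * real_of_int k / real M)"
  have pow: "cis (2 * pi * real j / real M) powi k = q ^ j" for j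
    by (simp add: q_def cis_power_int Complex.DeMoivre mult_ac)
  show "A = 0" if "0 < \<bar>k\<bar>" "\<bar>k\<bar> < int M"
  proof -
    have "q \<noteq> 1"
    proof
      assume "q = 1"
      then have "cos (2 * pi * real_of_int k / real M) = 1"
        by (metis q_def cis.sel(1) one_complex.sel(1))
      then obtain n :: int where "2 * pi * real_of_int k / real M = real_of_int n * 2 * pi"
        using cos_one_2pi_int by blast
      then have "real_of_int k = real_of_int n * real M"
        using assms by (simp add: field_simps)
      then have "k = n * int M"
        by (metis of_int_eq_iff of_int_mult of_int_of_nat_eq)
      then show False
        using that by (simp add: abs_mult) (metis dvd_triv_right zdvd_not_zless zero_less_mult_iff abs_mult
            abs_of_nat zero_less_abs_iff)
    qed
    moreover have "q ^ M = 1"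
      using assms by (simp add: q_def Complex.DeMoivre)
    ultimately show ?thesis
      by (simp add: A_def pow sum_gp_strict)
  qed
qed

text \<open>Averaging over the \<open>M\<close>-th roots of unity isolates a coefficient up to a tail of the
  absolutely convergent series.\<close>

lemma laurent_circle_unique:
  fixes c :: "int \<Rightarrow> complex"
  assumes "\<rho> > 0" and sum0: "\<And>z. cmod z = \<rho> \<Longrightarrow> ((\<lambda>k. c k * z powi k) has_sum 0) UNIV"
  shows "c k0 = 0"
proof (rule ccontr)
  assume nz: "c k0 \<noteq> 0"
  \<comment> \<open>Recentring at \<open>k0\<close> and scaling the radius to 1 leave the
    coefficient at \<open>k0\<close> unchanged: \<open>d k0 = c k0\<close>.\<close>
  define d where "d k = c k * of_real \<rho> powi (k - k0)" for k
  have d0: "cmod (d k0) > 0"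
    using nz by (simp add: d_def)
  define w where "w M j = cis (2 * pi * real j / real M)" for M j :: nat
  have "((\<lambda>k. d k * z powi (k - k0)) has_sum 0) UNIV" if "cmod z = 1" for z
  proof -
    have [simp]: "z \<noteq> 0" using that by auto
    have "((\<lambda>k. c k * (of_real \<rho> * z) powi k * (of_real \<rho> * z) powi (- k0)) has_sum 0) UNIV"
      using has_sum_cmult_left[OF sum0[of "of_real \<rho> * z"]] that \<open>\<rho> > 0\<close> by (simp add: norm_mult)
    moreover have "c k * (of_real \<rho> * z) powi k * (of_real \<rho> * z) powi (- k0) = d k * z powi (k - k0)" for k
      using \<open>\<rho> > 0\<close> by (simp add: d_def power_int_mult_distrib power_int_diff power_int_minus field_simps)
    ultimately show ?thesis by simp
  qed
  note dz = this
  have dsum: "d summable_on UNIV"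
    using dz[of 1] by (auto simp: summable_on_def)
  then have dabs: "d abs_summable_on UNIV"
    by (simp add: summable_on_iff_abs_summable_on_complex)
  define t where "t = (\<Sum>\<^sub>\<infinity>k. cmod (d k))"
  have "((\<lambda>k. cmod (d k)) has_sum t) UNIV"
    using dabs by (simp add: t_def)
  then have "(sum (\<lambda>k. cmod (d k)) \<longlongrightarrow> t) (finite_subsets_at_top UNIV)"
    by (simp add: has_sum_def)
  then have "\<forall>\<^sub>F F in finite_subsets_at_top UNIV. dist (sum (\<lambda>k. cmod (d k)) F) t < cmod (d k0)"
    using d0 by (rule tendstoD)
  then obtain F0 where "finite F0"
    and F0: "\<And>F. finite F \<Longrightarrow> F0 \<subseteq> F \<Longrightarrow> dist (sum (\<lambda>k. cmod (d k)) F) t < cmod (d k0)"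
    unfolding eventually_finite_subsets_at_top by auto
  define F where "F = insert k0 F0"
  have F: "finite F" "k0 \<in> F" "dist (sum (\<lambda>k. cmod (d k)) F) t < cmod (d k0)"
    using F0[of F] \<open>finite F0\<close> by (auto simp: F_def)
  \<comment> \<open>\<open>F\<close> carries all of the absolute sum but less than
    \<open>cmod (d k0)\<close>.\<close>
  have tail: "(\<Sum>\<^sub>\<infinity>k\<in>-F. cmod (d k)) < cmod (d k0)"
  proof -
    have "t = (\<Sum>\<^sub>\<infinity>k\<in>F. cmod (d k)) + (\<Sum>\<^sub>\<infinity>k\<in>-F. cmod (d k))"
      unfolding t_def using infsum_Un_disjoint[of "\<lambda>k. cmod (d k)" F "-F"] dabs F(1)
      by (auto intro: summable_on_subset_banach)
    then show ?thesis
      using F(1,3) by (auto simp: dist_real_def)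
  qed
  \<comment> \<open>With \<open>M\<close> above every distance from \<open>k0\<close> within
    \<open>F\<close>, averaging over the \<open>M\<close>-th roots of unity annihilates all terms of
    \<open>F\<close> except the one at \<open>k0\<close>.\<close>
  define M where "M = Suc (nat (Max ((\<lambda>k. \<bar>k - k0\<bar>) ` F)))"
  have "M > 0" by (simp add: M_def)
  have MF: "\<bar>k - k0\<bar> < int M" if "k \<in> F" for k
  proof -
    have "\<bar>k - k0\<bar> \<le> Max ((\<lambda>k. \<bar>k - k0\<bar>) ` F)"
      using that F(1) by (intro Max_ge) auto
    then show ?thesis unfolding M_def by linarith
  qed
  define A where "A k = (\<Sum>j<M. w M j powi (k - k0)) / of_nat M" for k
  have "((\<lambda>k. \<Sum>j<M. d k * w M j powi (k - k0)) has_sum (\<Sum>j<M. 0)) UNIV"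
    by (intro has_sum_finite_sum dz) (simp add: w_def)
  then have "((\<lambda>k. (\<Sum>j<M. d k * w M j powi (k - k0)) * inverse (of_nat M)) has_sum 0) UNIV"
    using has_sum_cmult_left by fastforce
  then have "((\<lambda>k. d k * A k) has_sum 0) UNIV"
    by (simp add: A_def divide_inverse sum_distrib_left mult_ac)
  then have "((\<lambda>k. d k * A k) has_sum (0 - d k0 * A k0)) (UNIV - {k0})"
    by (rule has_sum_Diff) (auto simp: has_sum_finite_iff)
  then have "((\<lambda>k. d k * A k) has_sum (- d k0)) (UNIV - {k0})"
    using cis_root_average(1)[OF \<open>M > 0\<close>, of "k0 - k0"] by (simp add: A_def w_def)
  then have "((\<lambda>k. d k * A k) has_sum (- d k0)) (- F)"
  proof (rule has_sum_cong_neutral[THEN iffD1, rotated -1])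
    fix k assume "k \<in> UNIV - {k0} - - F"
    then show "d k * A k = 0"
      using cis_root_average(3)[OF \<open>M > 0\<close>, of "k - k0"] MF[of k] by (simp add: A_def w_def)
  qed (use F in auto)
  \<comment> \<open>What survives is \<open>d k0\<close> plus a tail with weights \<open>A k\<close>
    of modulus at most 1, which is too small to cancel it.\<close>
  then have eq: "cmod (d k0) = cmod (\<Sum>\<^sub>\<infinity>k\<in>-F. d k * A k)"
    by (simp add: infsumI)
  have "cmod (A k) \<le> 1" for k
    using cis_root_average(2)[OF \<open>M > 0\<close>, of "k - k0"] by (simp add: A_def w_def)
  then have abs_le: "cmod (d k * A k) \<le> cmod (d k)" for k
    by (simp add: norm_mult mult_left_le)
  have s: "d abs_summable_on -F"
    using dabs by (rule summable_on_subset_banach) auto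
  then have s2: "(\<lambda>k. d k * A k) abs_summable_on -F"
    by (rule abs_summable_on_comparison_test) (use abs_le in auto)
  note eq
  also have "cmod (\<Sum>\<^sub>\<infinity>k\<in>-F. d k * A k) \<le> (\<Sum>\<^sub>\<infinity>k\<in>-F. cmod (d k * A k))"
    by (rule norm_infsum_bound[OF s2])
  also have "\<dots> \<le> (\<Sum>\<^sub>\<infinity>k\<in>-F. cmod (d k))"
    by (rule infsum_mono[OF s2 s abs_le])
  also have "\<dots> < cmod (d k0)" by (rule tail)
  finally show False by simp
qed

text \<open>Induction on the number of variables. With all variables but the first fixed on their
  circles, the inner sums are the Laurent coefficients of a series in the first variable, so they
  vanish by the one-variable case; each of them is again a series on a smaller torus.\<close>

lemma laurent_torus_unique:
  fixes c :: "int list \<Rightarrow> complex"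
  assumes "\<forall>\<rho>\<in>set \<rho>s. \<rho> > 0"
    and "\<And>zs. map cmod zs = \<rho>s \<Longrightarrow>
      ((\<lambda>ks. c ks * prod_list (map2 (powi) zs ks)) has_sum 0) {ks. length ks = length \<rho>s}"
    and "length ks = length \<rho>s"
  shows "c ks = 0"
  using assms
proof (induction \<rho>s arbitrary: c ks)
  case Nil
  have "{ks. length ks = length []} = {[] :: int list}" by auto
  with Nil.prems(2)[of "[]"] Nil.prems(3) show ?case
    by (simp add: has_sum_finite_iff)
next
  case (Cons \<rho> \<rho>s)
  let ?L = "{ks :: int list. length ks = length \<rho>s}"
  let ?g = "\<lambda>(k :: int, ks). k # ks"
  obtain k ks' where ks: "ks = k # ks'" "length ks' = length \<rho>s"
    using Cons.prems(3) by (cases ks) auto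
  have img: "{ks. length ks = length (\<rho> # \<rho>s)} = ?g ` (UNIV \<times> ?L)"
    by (auto simp: image_iff length_Suc_conv)
  have inj: "inj_on ?g (UNIV \<times> ?L)"
    by (auto simp: inj_on_def)
  have sum: "((\<lambda>(k, ks). c (k # ks) * (z powi k * prod_list (map2 (powi) zs ks))) has_sum 0) (UNIV \<times> ?L)"
    if "cmod z = \<rho>" "map cmod zs = \<rho>s" for z zs
    using Cons.prems(2)[of "z # zs"] that unfolding img has_sum_reindex[OF inj]
    by (simp add: o_def case_prod_unfold)
  have "((\<lambda>ks. c (k # ks) * prod_list (map2 (powi) zs ks)) has_sum 0) ?L"
    if zs: "map cmod zs = \<rho>s" for k zs
  proof -
    define b where "b k = (\<Sum>\<^sub>\<infinity>ks\<in>?L. c (k # ks) * prod_list (map2 (powi) zs ks))" for k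
    \<comment> \<open>Absolute summability of the double series at first coordinate
      \<open>of_real \<rho>\<close> passes to each slice; the nonzero constant
      \<open>of_real \<rho> powi k\<close> is then divided out.\<close>
    have summ: "(\<lambda>ks. c (k # ks) * prod_list (map2 (powi) zs ks)) summable_on ?L" for k
    proof -
      have [simp]: "\<rho> \<noteq> 0" using Cons.prems(1) by auto
      have "(\<lambda>(k, ks). c (k # ks) * (of_real \<rho> powi k * prod_list (map2 (powi) zs ks))) abs_summable_on (UNIV \<times> ?L)"
        using sum[of "of_real \<rho>" zs] zs Cons.prems(1)
        unfolding summable_on_iff_abs_summable_on_complex[symmetric] by (auto intro: has_sum_imp_summable)
      then have "(\<lambda>ks. c (k # ks) * (of_real \<rho> powi k * prod_list (map2 (powi) zs ks))) abs_summable_on ?L"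
        unfolding abs_summable_on_Sigma_iff by auto
      then have "(\<lambda>ks. c (k # ks) * (of_real \<rho> powi k * prod_list (map2 (powi) zs ks))) summable_on ?L"
        by (simp flip: summable_on_iff_abs_summable_on_complex)
      then have "(\<lambda>ks. of_real \<rho> powi (- k) * (c (k # ks) * (of_real \<rho> powi k * prod_list (map2 (powi) zs ks)))) summable_on ?L"
        by (rule summable_on_cmult_right)
      then show ?thesis
        by (simp add: power_int_minus field_simps)
    qed
    have "b k = 0"
    proof (rule laurent_circle_unique)
      show "\<rho> > 0" using Cons.prems(1) by simp
      show "((\<lambda>k. b k * z powi k) has_sum 0) UNIV" if "cmod z = \<rho>" for z
      proof (rule has_sum_Sigma'[OF sum[OF that zs]])
        fix k
        have "((\<lambda>ks. c (k # ks) * prod_list (map2 (powi) zs ks) * z powi k) has_sum b k * z powi k) ?L"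
          unfolding b_def by (intro has_sum_cmult_left has_sum_infsum summ)
        then show "((\<lambda>y. case (k, y) of (k, ks) \<Rightarrow> c (k # ks) * (z powi k * prod_list (map2 (powi) zs ks))) has_sum b k * z powi k) ?L"
          by (simp add: mult_ac)
      qed
    qed
    then show ?thesis
      using has_sum_infsum[OF summ[of k]] by (simp add: b_def)
  qed
  then have "c (k # ks') = 0"
    using Cons.prems(1) ks(2) by (intro Cons.IH[of "\<lambda>ks. c (k # ks)"]) auto
  with ks show ?case by simp
qed

section \<open>Rational functions on configurations\<close>

definition polynomial_function :: "nat \<Rightarrow> (complex list \<Rightarrow> complex) \<Rightarrow> bool" where
  "polynomial_function n f \<longleftrightarrow>
     (\<exists>A c. finite A \<and> A \<subseteq> {\<alpha>. length \<alpha> = n} \<and>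
       (\<forall>zs. length zs = n \<longrightarrow> f zs = (\<Sum>\<alpha>\<in>A. c \<alpha> * prod_list (map2 (^) zs \<alpha>))))"

lemma polynomial_function_monomial:
  assumes "length \<alpha> = n"
  shows "polynomial_function n (\<lambda>zs. c * prod_list (map2 (^) zs \<alpha>))"
  unfolding polynomial_function_def using assms
  by (intro exI[of _ "{\<alpha>}"] exI[of _ "\<lambda>_. c"]) auto

lemma polynomial_function_cong:
  assumes "polynomial_function n f" and "\<And>zs. length zs = n \<Longrightarrow> f zs = g zs"
  shows "polynomial_function n g"
  using assms unfolding polynomial_function_def by simp

lemma polynomial_function_add:
  assumes "polynomial_function n f" and "polynomial_function n g"
  shows "polynomial_function n (\<lambda>zs. f zs + g zs)"
proof -
  obtain A c where f: "finite A" "A \<subseteq> {\<alpha>. length \<alpha> = n}"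
    "\<And>zs. length zs = n \<Longrightarrow> f zs = (\<Sum>\<alpha>\<in>A. c \<alpha> * prod_list (map2 (^) zs \<alpha>))"
    using assms(1) unfolding polynomial_function_def by blast
  obtain B d where g: "finite B" "B \<subseteq> {\<alpha>. length \<alpha> = n}"
    "\<And>zs. length zs = n \<Longrightarrow> g zs = (\<Sum>\<alpha>\<in>B. d \<alpha> * prod_list (map2 (^) zs \<alpha>))"
    using assms(2) unfolding polynomial_function_def by blast
  define e where "e \<alpha> = (if \<alpha> \<in> A then c \<alpha> else 0) + (if \<alpha> \<in> B then d \<alpha> else 0)" for \<alpha>
  have "f zs + g zs = (\<Sum>\<alpha>\<in>A \<union> B. e \<alpha> * prod_list (map2 (^) zs \<alpha>))" if "length zs = n" for zs
  proof -
    have "f zs = (\<Sum>\<alpha>\<in>A \<union> B. (if \<alpha> \<in> A then c \<alpha> else 0) * prod_list (map2 (^) zs \<alpha>))"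
      unfolding f(3)[OF that] using f(1) g(1) by (intro sum.mono_neutral_cong_left) auto
    moreover have "g zs = (\<Sum>\<alpha>\<in>A \<union> B. (if \<alpha> \<in> B then d \<alpha> else 0) * prod_list (map2 (^) zs \<alpha>))"
      unfolding g(3)[OF that] using f(1) g(1) by (intro sum.mono_neutral_cong_left) auto
    ultimately show ?thesis
      by (simp add: e_def sum.distrib distrib_right)
  qed
  then show ?thesis
    unfolding polynomial_function_def using f(1,2) g(1,2)
    by (intro exI[of _ "A \<union> B"] exI[of _ e]) auto
qed

lemma polynomial_function_const: "polynomial_function n (\<lambda>_. c)"
proof (rule polynomial_function_cong)
  show "polynomial_function n (\<lambda>zs. c * prod_list (map2 (^) zs (replicate n 0)))"
    by (rule polynomial_function_monomial) simp
  fix zs :: "complex list"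
  assume "length zs = n"
  then show "c * prod_list (map2 (^) zs (replicate n 0)) = c"
    by (induction zs arbitrary: n) auto
qed

lemma polynomial_function_sum:
  assumes "\<And>i. i \<in> I \<Longrightarrow> polynomial_function n (f i)"
  shows "polynomial_function n (\<lambda>zs. \<Sum>i\<in>I. f i zs)"
  using assms
  by (induction I rule: infinite_finite_induct)
     (auto intro: polynomial_function_const polynomial_function_add)

lemma prod_list_map2_power_add:
  fixes zs :: "'a::comm_monoid_mult list"
  assumes "length \<alpha> = length zs" and "length \<beta> = length zs"
  shows "prod_list (map2 (^) zs (map2 (+) \<alpha> \<beta>))
    = prod_list (map2 (^) zs \<alpha>) * prod_list (map2 (^) zs \<beta>)"
  using assms
proof (induction zs arbitrary: \<alpha> \<beta>)
  case (Cons z zs)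
  then show ?case
    by (cases \<alpha>; cases \<beta>) (auto simp: power_add mult_ac)
qed simp

lemma polynomial_function_mult:
  assumes "polynomial_function n f" and "polynomial_function n g"
  shows "polynomial_function n (\<lambda>zs. f zs * g zs)"
proof -
  obtain A c where f: "finite A" "A \<subseteq> {\<alpha>. length \<alpha> = n}"
    "\<And>zs. length zs = n \<Longrightarrow> f zs = (\<Sum>\<alpha>\<in>A. c \<alpha> * prod_list (map2 (^) zs \<alpha>))"
    using assms(1) unfolding polynomial_function_def by blast
  obtain B d where g: "finite B" "B \<subseteq> {\<alpha>. length \<alpha> = n}"
    "\<And>zs. length zs = n \<Longrightarrow> g zs = (\<Sum>\<alpha>\<in>B. d \<alpha> * prod_list (map2 (^) zs \<alpha>))"
    using assms(2) unfolding polynomial_function_def by blast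
  show ?thesis
  proof (rule polynomial_function_cong)
    \<comment> \<open>Different pairs can have the same exponent sum, so the product is treated as a
      sum of single monomials instead of one coefficient family.\<close>
    show "polynomial_function n (\<lambda>zs. \<Sum>\<alpha>\<in>A. \<Sum>\<beta>\<in>B.
        (c \<alpha> * d \<beta>) * prod_list (map2 (^) zs (map2 (+) \<alpha> \<beta>)))"
      using f(2) g(2)
      by (intro polynomial_function_sum polynomial_function_monomial) (auto simp: subset_iff)
    fix zs :: "complex list"
    assume zs: "length zs = n"
    show "(\<Sum>\<alpha>\<in>A. \<Sum>\<beta>\<in>B. (c \<alpha> * d \<beta>) * prod_list (map2 (^) zs (map2 (+) \<alpha> \<beta>))) = f zs * g zs"
      unfolding f(3)[OF zs] g(3)[OF zs] sum_product
      using f(2) g(2) zs by (intro sum.cong) (auto simp: prod_list_map2_power_add subset_iff mult_ac)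
  qed
qed

lemma polynomial_function_power:
  "polynomial_function n f \<Longrightarrow> polynomial_function n (\<lambda>zs. f zs ^ k)"
  by (induction k) (auto intro: polynomial_function_const polynomial_function_mult)

lemma polynomial_function_prod:
  assumes "\<And>i. i \<in> I \<Longrightarrow> polynomial_function n (f i)"
  shows "polynomial_function n (\<lambda>zs. \<Prod>i\<in>I. f i zs)"
  using assms
  by (induction I rule: infinite_finite_induct)
     (auto intro: polynomial_function_const polynomial_function_mult)

lemma polynomial_function_nth:
  assumes "i < n"
  shows "polynomial_function n (\<lambda>zs. zs ! i)"
proof (rule polynomial_function_cong)
  show "polynomial_function n (\<lambda>zs. 1 * prod_list (map2 (^) zs ((replicate n 0)[i := 1])))"
    by (rule polynomial_function_monomial) simp
  fix zs :: "complex list"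
  assume "length zs = n"
  have zero: "prod_list (map2 (^) zs (replicate (length zs) 0)) = 1" for zs :: "complex list"
    by (induction zs) auto
  from \<open>length zs = n\<close> assms show "1 * prod_list (map2 (^) zs ((replicate n 0)[i := 1])) = zs ! i"
  proof (induction zs arbitrary: n i)
    case (Cons z zs)
    then show ?case
      using zero[of zs] by (cases i) (auto simp flip: Cons.prems(1))
  qed simp
qed

text \<open>The product of the coordinates times a Vandermonde product: on lists of length
  \<open>n\<close> it vanishes exactly off \<open>configurations n\<close>, and its powers are the
  allowed denominators.\<close>

definition polar_locus :: "nat \<Rightarrow> complex list \<Rightarrow> complex" where
  "polar_locus n zs = (\<Prod>i<n. zs ! i * (\<Prod>j<i. zs ! j - zs ! i))"

lemma polar_locus_nonzero: "zs \<in> configurations n \<Longrightarrow> polar_locus n zs \<noteq> 0"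
  by (auto simp: polar_locus_def configurations_def nth_eq_iff_index_eq in_set_conv_nth)

lemma polynomial_function_polar_locus: "polynomial_function n (polar_locus n)"
proof (rule polynomial_function_cong)
  show "polynomial_function n (\<lambda>zs. \<Prod>i<n. zs ! i * (\<Prod>j<i. zs ! j + (-1) * zs ! i))"
    by (intro polynomial_function_prod polynomial_function_mult polynomial_function_nth
        polynomial_function_add polynomial_function_const) auto
qed (simp add: polar_locus_def)

text \<open>Collecting the denominator into a power of one polynomial gives two such functions the
  common denominator \<open>polar_locus n zs ^ (N + N')\<close>, which makes closure under addition
  immediate.\<close>

lemma rational_on_configurations_iff:
  "rational_on_configurations n R \<longleftrightarrow>
     (\<exists>P N. polynomial_function n P \<and> (\<forall>zs\<in>configurations n. R zs = P zs / polar_locus n zs ^ N))"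
proof -
  have den: "(\<Prod>i<n. (zs ! i) ^ N * (\<Prod>j<i. (zs ! j - zs ! i) ^ N)) = polar_locus n zs ^ N"
    for zs :: "complex list" and N
    by (simp add: polar_locus_def prod_power_distrib power_mult_distrib)
  show ?thesis
  proof
    assume "rational_on_configurations n R"
    then obtain A c N where *: "finite A" "A \<subseteq> {\<alpha>. length \<alpha> = n}"
      "\<And>zs. zs \<in> configurations n \<Longrightarrow>
        R zs = (\<Sum>\<alpha>\<in>A. c \<alpha> * prod_list (map2 (^) zs \<alpha>)) / polar_locus n zs ^ N"
      unfolding rational_on_configurations_def den by blast
    then have "polynomial_function n (\<lambda>zs. \<Sum>\<alpha>\<in>A. c \<alpha> * prod_list (map2 (^) zs \<alpha>))"
      by (intro polynomial_function_sum polynomial_function_monomial) auto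
    with *(3) show "\<exists>P N. polynomial_function n P \<and> (\<forall>zs\<in>configurations n. R zs = P zs / polar_locus n zs ^ N)"
      by blast
  next
    assume "\<exists>P N. polynomial_function n P \<and> (\<forall>zs\<in>configurations n. R zs = P zs / polar_locus n zs ^ N)"
    then obtain P N where P: "polynomial_function n P"
      "\<forall>zs\<in>configurations n. R zs = P zs / polar_locus n zs ^ N" by blast
    then obtain A c where "finite A" "A \<subseteq> {\<alpha>. length \<alpha> = n}"
      "\<And>zs. length zs = n \<Longrightarrow> P zs = (\<Sum>\<alpha>\<in>A. c \<alpha> * prod_list (map2 (^) zs \<alpha>))"
      unfolding polynomial_function_def by blast
    with P show "rational_on_configurations n R"
      unfolding rational_on_configurations_def den
      by (intro exI[of _ A] exI[of _ c] exI[of _ N]) (auto simp: configurations_def)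
  qed
qed

lemma rational_on_configurations_add:
  assumes "rational_on_configurations n R" and "rational_on_configurations n R'"
  shows "rational_on_configurations n (\<lambda>zs. R zs + R' zs)"
proof -
  obtain P N where P: "polynomial_function n P"
    "\<forall>zs\<in>configurations n. R zs = P zs / polar_locus n zs ^ N"
    using assms(1) by (auto simp: rational_on_configurations_iff)
  obtain P' N' where P': "polynomial_function n P'"
    "\<forall>zs\<in>configurations n. R' zs = P' zs / polar_locus n zs ^ N'"
    using assms(2) by (auto simp: rational_on_configurations_iff)
  have "polynomial_function n (\<lambda>zs. P zs * polar_locus n zs ^ N' + P' zs * polar_locus n zs ^ N)"
    by (intro polynomial_function_add polynomial_function_mult polynomial_function_power
        polynomial_function_polar_locus P(1) P'(1))
  moreover have "\<forall>zs\<in>configurations n. R zs + R' zs =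
      (P zs * polar_locus n zs ^ N' + P' zs * polar_locus n zs ^ N) / polar_locus n zs ^ (N + N')"
    using P(2) P'(2) by (auto simp: polar_locus_nonzero power_add add_frac_eq)
  ultimately show ?thesis
    unfolding rational_on_configurations_iff by blast
qed

lemma rational_on_configurations_cmult:
  assumes "rational_on_configurations n R"
  shows "rational_on_configurations n (\<lambda>zs. c * R zs)"
proof -
  obtain P N where P: "polynomial_function n P"
    "\<forall>zs\<in>configurations n. R zs = P zs / polar_locus n zs ^ N"
    using assms by (auto simp: rational_on_configurations_iff)
  have "polynomial_function n (\<lambda>zs. c * P zs)"
    by (intro polynomial_function_mult polynomial_function_const P(1))
  with P(2) show ?thesis
    unfolding rational_on_configurations_iff by (metis times_divide_eq_right)
qed

lemma rational_on_configurations_sum: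
  assumes "\<And>i. i \<in> I \<Longrightarrow> rational_on_configurations n (R i)"
  shows "rational_on_configurations n (\<lambda>zs. \<Sum>i\<in>I. R i zs)"
proof -
  have "rational_on_configurations n (\<lambda>_. 0)"
    unfolding rational_on_configurations_iff
    by (intro exI[of _ "\<lambda>_. 0"] exI[of _ 0]) (simp add: polynomial_function_const)
  then show ?thesis
    using assms
    by (induction I rule: infinite_finite_induct) (auto intro: rational_on_configurations_add)
qed

text \<open>Restriction to a line with fixed second coordinate makes the finiteness of the roots of
  a univariate polynomial available.\<close>

lemma polynomial_function_2_section:
  assumes "polynomial_function 2 P"
  obtains p where "\<And>z. P [z, z2] = poly p z"
proof -
  obtain A c where A: "finite A" "A \<subseteq> {\<alpha>. length \<alpha> = 2}"
    "\<And>zs. length zs = 2 \<Longrightarrow> P zs = (\<Sum>\<alpha>\<in>A. c \<alpha> * prod_list (map2 (^) zs \<alpha>))"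
    using assms unfolding polynomial_function_def by blast
  have "P [z, z2] = poly (\<Sum>\<alpha>\<in>A. monom (c \<alpha> * z2 ^ (\<alpha> ! 1)) (\<alpha> ! 0)) z" for z
    using A by (auto simp: poly_sum poly_monom intro!: sum.cong)
      (auto simp: length_Suc_conv numeral_2_eq_2 dest!: subsetD)
  then show ?thesis by (rule that)
qed

text \<open>For fixed \<open>z\<^sub>2\<close> the difference, with denominators cleared, is a polynomial in \<open>z\<^sub>1\<close> with
  infinitely many zeros.\<close>

lemma rational_on_configurations_2_eqI:
  assumes "rational_on_configurations 2 R" and "rational_on_configurations 2 R'"
    and eq: "\<And>z1 z2. cmod z1 > cmod z2 \<Longrightarrow> cmod z2 > 0 \<Longrightarrow> R [z1, z2] = R' [z1, z2]"
    and "[z1, z2] \<in> configurations 2"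
  shows "R [z1, z2] = R' [z1, z2]"
proof -
  have "rational_on_configurations 2 (\<lambda>zs. R zs + (-1) * R' zs)"
    by (intro rational_on_configurations_add rational_on_configurations_cmult assms)
  then obtain P N where P: "polynomial_function 2 P"
    "\<forall>zs\<in>configurations 2. R zs + (-1) * R' zs = P zs / polar_locus 2 zs ^ N"
    unfolding rational_on_configurations_iff by blast
  obtain p where p: "\<And>z. P [z, z2] = poly p z"
    using polynomial_function_2_section[OF P(1)] by blast
  have z2: "z2 \<noteq> 0" using assms(4) by (auto simp: configurations_def)
  \<comment> \<open>The real points beyond \<open>cmod z2\<close> already lie in the region of known
    agreement and supply infinitely many zeros.\<close>
  have root: "poly p (of_real x) = 0" if "x > cmod z2" for x
  proof -
    have "[of_real x, z2] \<in> configurations 2"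
      using that z2 by (auto simp: configurations_def)
    moreover have "R [of_real x, z2] = R' [of_real x, z2]"
      using that z2 by (intro eq) auto
    ultimately show ?thesis
      using P(2) polar_locus_nonzero[of "[of_real x, z2]" 2] by (auto simp: p)
  qed
  have "infinite (of_real ` {cmod z2 <..} :: complex set)"
    using infinite_Ioi[of "cmod z2"] by (simp add: finite_image_iff inj_on_def)
  moreover have "of_real ` {cmod z2 <..} \<subseteq> {z. poly p z = 0}"
    using root by auto
  ultimately have "p = 0"
    using poly_roots_finite finite_subset by blast
  then show ?thesis
    using P(2) assms(4) p[of z1] by auto
qed

text \<open>For complex series unconditional and absolute summability coincide, so only
  \<open>has_sum\<close> has to be tracked from here on.\<close>

lemma converges_absolutely_to_iff:
  "converges_absolutely_to n \<phi> f zs s \<longleftrightarrow>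
     ((\<lambda>ks. \<phi> (f ks) * prod_list (map2 (powi) zs ks)) has_sum s) {ks. length ks = n}"
  unfolding converges_absolutely_to_def
  by (metis has_sum_imp_summable summable_on_iff_abs_summable_on_complex)

text \<open>Agreement of the sums on a single torus suffices: \<open>laurent_torus_unique\<close>
  applies to the difference of the two coefficient families. The torus may be chosen inside
  whichever region of convergence is at hand.\<close>

lemma converges_absolutely_to_unique:
  assumes "\<forall>\<rho>\<in>set \<rho>s. \<rho> > 0" and "length \<rho>s = n"
    and "\<And>zs. map cmod zs = \<rho>s \<Longrightarrow>
      \<exists>s. converges_absolutely_to n \<phi> f zs s \<and> converges_absolutely_to n \<phi> g zs s"
    and "length ks = n"
  shows "\<phi> (f ks) = \<phi> (g ks)"
proof -
  have "\<phi> (f ks) - \<phi> (g ks) = 0"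
  proof (rule laurent_torus_unique[where c = "\<lambda>ks. \<phi> (f ks) - \<phi> (g ks)"])
    fix zs assume "map cmod zs = \<rho>s"
    then obtain s where "converges_absolutely_to n \<phi> f zs s" "converges_absolutely_to n \<phi> g zs s"
      using assms(3) by blast
    then have "((\<lambda>ks. \<phi> (f ks) * prod_list (map2 (powi) zs ks)
        + - (\<phi> (g ks) * prod_list (map2 (powi) zs ks))) has_sum (s + - s)) {ks. length ks = n}"
      unfolding converges_absolutely_to_iff by (intro has_sum_add has_sum_uminusI)
    then show "((\<lambda>ks. (\<phi> (f ks) - \<phi> (g ks)) * prod_list (map2 (powi) zs ks)) has_sum 0)
        {ks. length ks = length \<rho>s}"
      using assms(2) by (simp add: algebra_simps)
  qed (use assms in auto)
  then show ?thesis by simp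
qed

section \<open>Modes, translation and grading\<close>

context vertex_algebra
begin

lemma mode_hom_left: "module_hom smul smul (\<lambda>u. mode Y u n v)"
  and mode_hom_right: "module_hom smul smul (\<lambda>v. mode Y u n v)"
  using Y_bilinear by (simp_all add: bilinear_series_def mode_def linear_iff_module_hom)

lemma mode_zero_left [simp]: "mode Y 0 n v = 0"
  and mode_zero_right [simp]: "mode Y u n 0 = 0"
  using module_hom.zero[OF mode_hom_left] module_hom.zero[OF mode_hom_right] by simp_all

lemma mode_vac: "mode Y vac n v = (if n = -1 then v else 0)"
  by (auto simp: mode_def identity)

lemma mode_creation: "mode Y u (-1) vac = u" and mode_annihilation: "n \<ge> 0 \<Longrightarrow> mode Y u n vac = 0"
  by (simp_all add: mode_def creation_limit creation_regular)

text \<open>This is the Borcherds identity with \<open>(l, m, n) := (n, 0, -2)\<close> applied to the vacuum.\<close>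

lemma translation_mode:
  "translation_op Y vac (mode Y u n v)
    = mode Y u n (translation_op Y vac v) - smul (of_int n) (mode Y u (n - 1) v)"
proof -
  define L where "L = (\<lambda>i::nat. smul ((-1) ^ i * (of_int n gchoose i))
      (mode Y u (n - int i) (mode Y v (- 2 + int i) vac)
        - smul ((-1) powi n) (mode Y v (- 2 + n - int i) (mode Y u (int i) vac))))"
  define R where "R = (\<lambda>i::nat. smul (of_int 0 gchoose i)
      (mode Y (mode Y u (n + int i) v) (- 2 - int i) vac))"
  have "Sum_any L = Sum_any R"
    using jacobi[of n u 0 v "-2" vac] by (simp add: L_def R_def)
  \<comment> \<open>The binomials of 0 leave only \<open>i = 0\<close> in \<open>R\<close>, which is
    the left-hand side of the claim. In \<open>L\<close> all nonnegative modes kill the vacuum, so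
    \<open>i = 0\<close> gives \<open>mode Y u n\<close> of the translate of \<open>v\<close> and
    \<open>i = 1\<close> gives the correction with factor \<open>- n\<close>.\<close>
  moreover have "Sum_any R = (\<Sum>i\<in>{0}. R i)"
    by (rule Sum_any.expand_superset) (auto simp: R_def gbinomial_0_left split: if_splits)
  moreover have "Sum_any L = (\<Sum>i\<in>{0, 1}. L i)"
  proof (rule Sum_any.expand_superset)
    show "{i. L i \<noteq> 0} \<subseteq> {0, 1}"
    proof (intro subsetI, rule ccontr)
      fix i assume "i \<in> {i. L i \<noteq> 0}" "i \<notin> {0, 1}"
      then have "mode Y v (- 2 + int i) vac = 0"
        by (intro mode_annihilation) auto
      with \<open>i \<in> {i. L i \<noteq> 0}\<close> show False by (simp add: L_def mode_annihilation)
    qed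
  qed simp
  ultimately show ?thesis
    by (simp add: L_def R_def translation_op_def mode_annihilation mode_creation)
qed

lemma translation_vac: "translation_op Y vac vac = 0"
  by (simp add: translation_op_def mode_vac)

text \<open>Since \<open>vac\<close> is translation invariant, \<open>translation_mode\<close> at
  \<open>- int m\<close> has only its correction term. Iterated from \<open>mode_creation\<close>,
  this writes every negative mode on the vacuum as a divided power of translation applied to
  \<open>u\<close>.\<close>

lemma mode_vac_Suc:
  assumes "m \<ge> 1"
  shows "mode Y u (- int (Suc m)) vac = smul (1 / of_nat m) (translation_op Y vac (mode Y u (- int m) vac))"
proof -
  have index: "- int m - 1 = - int (Suc m)" by simp
  have "translation_op Y vac (mode Y u (- int m) vac) = smul (of_nat m) (mode Y u (- int (Suc m)) vac)"
    by (simp add: translation_mode translation_vac index del: of_nat_Suc)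
  then show ?thesis using assms by simp
qed

lemma mode_product_hom: "module_hom smul smul (foldr (\<lambda>(s, n) v. mode Y s n v) ps)"
proof (induction ps)
  case Nil
  then show ?case using linear_ident by (simp add: linear_iff_module_hom)
next
  case (Cons q qs)
  then show ?case
    using module_hom_compose[OF Cons mode_hom_right[of "fst q" "snd q"]]
    by (simp add: case_prod_unfold o_def)
qed

text \<open>Moving the translation operator outwards through a product of modes only lowers the modes.\<close>

lemma mode_product_translation:
  assumes "subspace K" and "\<And>v. v \<in> K \<Longrightarrow> translation_op Y vac v \<in> K"
    and "\<And>ps. fst ` set ps \<subseteq> S \<Longrightarrow> foldr (\<lambda>(s, n) v. mode Y s n v) ps x \<in> K"
    and "fst ` set ps \<subseteq> S"
  shows "foldr (\<lambda>(s, n) v. mode Y s n v) ps (translation_op Y vac x) \<in> K"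
  using assms(3,4)
\<comment> \<open>The letter next to \<open>x\<close> is peeled off. Translation passes it at the
  cost of a term with mode \<open>n - 1\<close>, which lies in \<open>K\<close> by hypothesis, and
  the induction hypothesis is applied to \<open>mode Y s n x\<close> in place of
  \<open>x\<close>.\<close>
proof (induction ps arbitrary: x rule: rev_induct)
  case Nil
  then show ?case using assms(2) Nil.prems(1)[of "[]"] by simp
next
  case (snoc p ps)
  let ?op = "foldr (\<lambda>(s, n) v. mode Y s n v)"
  obtain s n where p: "p = (s, n)" by (cases p)
  note lin = mode_product_hom[of ps]
  have K: "?op ps (mode Y s n' x) \<in> K" for n'
    using snoc.prems(1)[of "ps @ [(s, n')]"] snoc.prems(2) p by simp
  have "?op ps (translation_op Y vac (mode Y s n x)) \<in> K"
  proof (rule snoc.IH)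
    show "?op qs (mode Y s n x) \<in> K" if "fst ` set qs \<subseteq> S" for qs
      using snoc.prems(1)[of "qs @ [(s, n)]"] snoc.prems(2) p that by simp
  qed (use snoc.prems in auto)
  then have "?op ps (translation_op Y vac (mode Y s n x)) + smul (of_int n) (?op ps (mode Y s (n - 1) x)) \<in> K"
    using K assms(1) by (intro subspace_add subspace_scale)
  also have "?op ps (translation_op Y vac (mode Y s n x)) + smul (of_int n) (?op ps (mode Y s (n - 1) x))
      = ?op (ps @ [p]) (translation_op Y vac x)"
    by (simp add: p translation_mode module_hom.diff[OF lin] module_hom.scale[OF lin])
  finally show ?case .
qed

end

section \<open>Independence of weight components and the weight of the vacuum\<close>

context grading_restricted_vertex_algebra
begin

text \<open>This is the uniqueness of the decomposition of 0, transported along \<open>d\<close>;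
  the injective relabelling allows families whose weights are shifted by a constant.\<close>

lemma graded_sum_zero:
  assumes "finite I" and "inj_on d I" and "\<And>i. i \<in> I \<Longrightarrow> x i \<in> V (d i)" and "sum x I = 0" and "i \<in> I"
  shows "x i = 0"
proof -
  define y where "y n = (if n \<in> d ` I then x (the_inv_into I d n) else 0)" for n
  have yd: "y (d i) = x i" if "i \<in> I" for i
    using that assms(2) by (simp add: y_def the_inv_into_f_f)
  have supp: "{n. y n \<noteq> 0} \<subseteq> d ` I"
    by (auto simp: y_def)
  have "Sum_any y = sum y (d ` I)"
    using supp assms(1) by (intro Sum_any.expand_superset) auto
  also have "\<dots> = sum x I"
    using assms(2) yd by (simp add: sum.reindex)
  finally have "Sum_any y = 0" using assms(4) by simp
  moreover have "y n \<in> V n" for n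
    using yd assms(3) homogeneous_subspace[of n] by (auto simp: y_def subspace_0)
  moreover have "finite {n. y n \<noteq> 0}"
    using supp assms(1) by (simp add: finite_subset)
  ultimately have "y = (\<lambda>_. 0)"
    using direct_sum[of 0] homogeneous_subspace by (auto simp: subspace_0)
  then show ?thesis using yd[OF assms(5)] by (simp add: fun_eq_iff)
qed

lemma homogeneous_decomposition:
  obtains w I where "\<And>n. w n \<in> V n" and "finite I" and "v = sum w I"
  using direct_sum[of v] Sum_any.expand_set by metis

text \<open>The modes of index \<open>-1\<close> of the components of the vacuum of nonzero weight vanish.\<close>

lemma vac_weight_zero: "vac \<in> V 0"
proof -
  obtain w I where w: "\<And>n. w n \<in> V n" "finite I" "vac = sum w I"
    using homogeneous_decomposition by blast
  have zero: "mode Y (w n) (-1) v = 0" if "v \<in> V l" "n \<in> I" "n \<noteq> 0" for n l v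
  proof -
    \<comment> \<open>The identity \<open>v = mode Y vac (-1) v\<close>, expanded over the
      components of \<open>vac\<close>, has its \<open>k\<close>-th term in weight
      \<open>k + l\<close>. Moving \<open>v\<close> to degree 0 of the index gives a vanishing sum;
      0 is inserted because \<open>I\<close> may omit it.\<close>
    define x where "x k = mode Y (if k \<in> I then w k else 0) (-1) v - (if k = 0 then v else 0)" for k
    have "x n = 0"
    proof (rule graded_sum_zero[where I = "insert 0 I" and d = "\<lambda>k. k + l"])
      show "x k \<in> V (k + l)" for k
        using w(1)[of k] weight_mode[of "w k" k v l "-1"] that(1) homogeneous_subspace[of "k + l"]
        by (auto simp: x_def subspace_0 subspace_diff subspace_neg)
      have "sum x (insert 0 I) = (\<Sum>k\<in>insert 0 I. mode Y (if k \<in> I then w k else 0) (-1) v) - v"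
        unfolding x_def using w(2) by (simp add: sum_subtractf)
      also have "(\<Sum>k\<in>insert 0 I. mode Y (if k \<in> I then w k else 0) (-1) v) = (\<Sum>k\<in>I. mode Y (w k) (-1) v)"
        using w(2) by (intro sum.mono_neutral_cong_right) auto
      also have "\<dots> = mode Y vac (-1) v"
        unfolding w(3) by (simp add: module_hom.sum[OF mode_hom_left])
      finally show "sum x (insert 0 I) = 0" by (simp add: mode_vac)
    qed (use w that in auto)
    then show ?thesis using that by (simp add: x_def)
  qed
  have "w n = 0" if "n \<in> I" "n \<noteq> 0" for n
  proof -
    have "w n = mode Y (w n) (-1) (sum w I)"
      by (simp add: mode_creation flip: w(3))
    also have "\<dots> = (\<Sum>k\<in>I. mode Y (w n) (-1) (w k))"
      by (rule module_hom.sum[OF mode_hom_right])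
    also have "\<dots> = 0"
      using zero[OF w(1) that] by simp
    finally show ?thesis .
  qed
  then have "sum w I \<in> V 0"
    using w(1) homogeneous_subspace[of 0] by (intro subspace_sum) (metis subspace_0)+
  then show ?thesis using w(3) by simp
qed

end

section \<open>Homogeneous bases and the graded dual\<close>

text \<open>Homogeneity puts the coordinate functionals into the graded dual, where they separate
  points. Finiteness in each weight makes every element of the graded dual a finite combination of
  them. The values of \<open>wt\<close> matter only on \<open>B\<close>.\<close>

locale homogeneous_basis = grading_restricted_vertex_algebra smul Y vac V
  for smul :: "complex \<Rightarrow> 'v::ab_group_add \<Rightarrow> 'v"
    and Y :: "'v \<Rightarrow> 'v \<Rightarrow> 'v fls"
    and vac :: 'v
    and V :: "int \<Rightarrow> 'v set" +
  fixes B :: "'v set" and wt :: "'v \<Rightarrow> int"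
  assumes independent_basis: "independent B"
    and span_basis: "span B = UNIV"
    and basis_weight: "b \<in> B \<Longrightarrow> b \<in> V (wt b)"
    and finite_weight: "finite {b \<in> B. wt b = n}"
begin

text \<open>Group the basis expansion of \<open>v\<close> by weight and subtract \<open>v\<close> in
  degree \<open>n\<close>: independence of weight components kills every group of another weight,
  and independence of \<open>B\<close> then kills its coefficients.\<close>

lemma representation_weight:
  assumes "v \<in> V n" and "representation B v b \<noteq> 0"
  shows "wt b = n"
proof (rule ccontr)
  assume ne: "wt b \<noteq> n"
  define Q where "Q = {b. representation B v b \<noteq> 0}"
  have fin: "finite Q" and QB: "Q \<subseteq> B"
    using representation_ne_zero by (auto simp: Q_def finite_representation)
  have v: "(\<Sum>b\<in>Q. smul (representation B v b) b) = v"
    unfolding Q_def using independent_basis span_basis by (intro sum_nonzero_representation_eq) auto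
  define y where "y k = (\<Sum>b\<in>{b\<in>Q. wt b = k}. smul (representation B v b) b) - (if k = n then v else 0)" for k
  have "y (wt b) = 0"
  proof (rule graded_sum_zero[where I = "insert n (wt ` Q)" and d = id])
    show "y k \<in> V (id k)" if "k \<in> insert n (wt ` Q)" for k
    proof -
      have "(\<Sum>b\<in>{b\<in>Q. wt b = k}. smul (representation B v b) b) \<in> V k"
        using QB basis_weight homogeneous_subspace by (intro subspace_sum subspace_scale) auto
      then show ?thesis
        using assms(1) homogeneous_subspace[of k] by (auto simp: y_def subspace_diff)
    qed
    have "sum y (insert n (wt ` Q))
        = (\<Sum>k\<in>insert n (wt ` Q). \<Sum>b\<in>{b\<in>Q. wt b = k}. smul (representation B v b) b) - v"
      unfolding y_def using fin by (simp add: sum_subtractf)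
    also have "(\<Sum>k\<in>insert n (wt ` Q). \<Sum>b\<in>{b\<in>Q. wt b = k}. smul (representation B v b) b) = v"
      using sum.group[OF fin, of "insert n (wt ` Q)" wt "\<lambda>b. smul (representation B v b) b"] fin v
      by auto
    finally show "sum y (insert n (wt ` Q)) = 0" by simp
  qed (use fin assms(2) in \<open>auto simp: Q_def\<close>)
  then have "(\<Sum>b\<in>{b\<in>Q. wt b = wt b'}. smul (representation B v b) b) = 0" if "b' = b" for b'
    using ne that by (simp add: y_def)
  then have "representation B v b = 0"
    using QB fin assms(2)
    by (intro independentD[OF independent_basis, of "{b'\<in>Q. wt b' = wt b}" "representation B v" b]) (auto simp: Q_def)
  with assms(2) show False by simp
qed

lemma representation_in_graded_dual: "(\<lambda>v. representation B v b) \<in> graded_dual smul V"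
proof -
  have "{n. \<exists>v\<in>V n. representation B v b \<noteq> 0} \<subseteq> {wt b}"
    using representation_weight by blast
  then show ?thesis
    using linear_representation[OF independent_basis span_basis]
    by (auto simp: graded_dual_def intro: finite_subset)
qed

lemma graded_dual_separates:
  assumes "\<And>\<phi>. \<phi> \<in> graded_dual smul V \<Longrightarrow> \<phi> x = \<phi> y"
  shows "x = y"
proof -
  have "representation B x = representation B y"
    using assms[OF representation_in_graded_dual] by (simp add: fun_eq_iff)
  then show ?thesis
    using sum_nonzero_representation_eq[OF independent_basis] span_basis by (metis UNIV_I)
qed

text \<open>A functional in the graded dual sees finitely many weights, each containing finitely
  many basis vectors. Convergence and rationality therefore need checking on coordinates
  only.\<close>

lemma graded_dual_expansion:
  assumes "\<phi> \<in> graded_dual smul V"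
  shows "finite {b\<in>B. \<phi> b \<noteq> 0}"
    and "\<phi> v = (\<Sum>b\<in>{b\<in>B. \<phi> b \<noteq> 0}. \<phi> b * representation B v b)"
proof -
  have lin: "Vector_Spaces.linear smul (*) \<phi>" and "finite {n. \<exists>v\<in>V n. \<phi> v \<noteq> 0}"
    using assms by (auto simp: graded_dual_def)
  then have "finite (\<Union>n\<in>{n. \<exists>v\<in>V n. \<phi> v \<noteq> 0}. {b\<in>B. wt b = n})"
    using finite_weight by blast
  then show fin: "finite {b\<in>B. \<phi> b \<noteq> 0}"
    by (rule rev_finite_subset) (use basis_weight in blast)
  interpret \<phi>: Vector_Spaces.linear smul "(*)" \<phi> by (rule lin)
  define Q where "Q = {b. representation B v b \<noteq> 0}"
  have "finite Q" and QB: "Q \<subseteq> B"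
    using representation_ne_zero by (auto simp: Q_def finite_representation)
  have "(\<Sum>b\<in>Q. smul (representation B v b) b) = v"
    unfolding Q_def using independent_basis span_basis by (intro sum_nonzero_representation_eq) auto
  then have "\<phi> v = (\<Sum>b\<in>Q. representation B v b * \<phi> b)"
    by (metis (no_types, lifting) \<phi>.sum \<phi>.scale sum.cong)
  also have "\<dots> = (\<Sum>b\<in>{b\<in>B. \<phi> b \<noteq> 0}. \<phi> b * representation B v b)"
    using fin \<open>finite Q\<close> QB by (intro sum.mono_neutral_cong) (auto simp: Q_def)
  finally show "\<phi> v = \<dots>" .
qed

text \<open>As \<open>E_fun\<close> is a choice, its defining property holds only once some
  candidate has it. The rational functions \<open>R b\<close> of the coordinates are assembled into
  one, \<open>F\<close>, whose component in each weight is a finite sum.\<close>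

lemma converges_absolutely_to_E_fun:
  assumes "E_well_defined smul V n f"
    and "\<phi> \<in> graded_dual smul V" and "zs \<in> product_region n"
  shows "converges_absolutely_to n \<phi> f zs (pairing \<phi> (E_fun smul V n f zs))"
proof -
  have "\<exists>R. rational_on_configurations n R \<and>
      (\<forall>zs\<in>product_region n. converges_absolutely_to n (\<lambda>v. representation B v b) f zs (R zs))" for b
    using assms(1) representation_in_graded_dual unfolding E_well_defined_def by blast
  then obtain R where R: "\<And>b. rational_on_configurations n (R b)"
    "\<And>b zs. zs \<in> product_region n \<Longrightarrow> converges_absolutely_to n (\<lambda>v. representation B v b) f zs (R b zs)"
    by metis
  define F where "F zs m = (\<Sum>b\<in>{b\<in>B. wt b = m}. smul (R b zs) b)" for zs m
  have "F zs \<in> graded_completion V" for zs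
    using basis_weight homogeneous_subspace
    by (auto simp: graded_completion_def F_def intro!: subspace_sum subspace_scale)
  moreover have "rational_on_configurations n (\<lambda>zs. pairing \<phi> (F zs)) \<and>
      (\<forall>zs\<in>product_region n. converges_absolutely_to n \<phi> f zs (pairing \<phi> (F zs)))"
    if \<phi>: "\<phi> \<in> graded_dual smul V" for \<phi>
  proof -
    interpret \<phi>: Vector_Spaces.linear smul "(*)" \<phi>
      using \<phi> unfolding graded_dual_def by blast
    define Q where "Q = {b\<in>B. \<phi> b \<noteq> 0}"
    have fin: "finite Q" and exp: "\<phi> v = (\<Sum>b\<in>Q. \<phi> b * representation B v b)" for v
      unfolding Q_def by (rule graded_dual_expansion[OF \<phi>])+
    have \<phi>F: "\<phi> (F zs m) = (\<Sum>b\<in>{b\<in>Q. wt b = m}. \<phi> b * R b zs)" for zs m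
    proof -
      have "\<phi> (F zs m) = (\<Sum>b\<in>{b\<in>B. wt b = m}. R b zs * \<phi> b)"
        by (simp add: F_def \<phi>.sum \<phi>.scale)
      also have "\<dots> = (\<Sum>b\<in>{b\<in>Q. wt b = m}. \<phi> b * R b zs)"
        using finite_weight[of m] by (intro sum.mono_neutral_cong_right) (auto simp: Q_def)
      finally show ?thesis .
    qed
    have pair: "pairing \<phi> (F zs) = (\<Sum>b\<in>Q. \<phi> b * R b zs)" for zs
    proof -
      have "pairing \<phi> (F zs) = (\<Sum>m\<in>wt ` Q. \<phi> (F zs m))"
        unfolding pairing_def
      proof (rule Sum_any.expand_superset)
        show "{m. \<phi> (F zs m) \<noteq> 0} \<subseteq> wt ` Q"
          unfolding \<phi>F by (auto elim: sum.not_neutral_contains_not_neutral)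
      qed (use fin in simp)
      also have "\<dots> = (\<Sum>b\<in>Q. \<phi> b * R b zs)"
        unfolding \<phi>F using fin by (intro sum.group) auto
      finally show ?thesis .
    qed
    have "converges_absolutely_to n \<phi> f zs (pairing \<phi> (F zs))" if "zs \<in> product_region n" for zs
    proof -
      have "((\<lambda>ks. \<Sum>b\<in>Q. \<phi> b * (representation B (f ks) b * prod_list (map2 (powi) zs ks)))
          has_sum (\<Sum>b\<in>Q. \<phi> b * R b zs)) {ks. length ks = n}"
        using R(2)[OF that] unfolding converges_absolutely_to_iff
        by (intro has_sum_finite_sum has_sum_cmult_right)
      moreover have "(\<Sum>b\<in>Q. \<phi> b * (representation B (f ks) b * prod_list (map2 (powi) zs ks)))
          = \<phi> (f ks) * prod_list (map2 (powi) zs ks)" for ks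
        by (subst exp[of "f ks"]) (simp only: sum_distrib_right mult.assoc)
      ultimately show ?thesis
        by (simp only: converges_absolutely_to_iff pair)
    qed
    moreover have "rational_on_configurations n (\<lambda>zs. pairing \<phi> (F zs))"
      unfolding pair by (intro rational_on_configurations_sum rational_on_configurations_cmult R)
    ultimately show ?thesis by blast
  qed
  ultimately have "\<exists>F. (\<forall>zs\<in>configurations n. F zs \<in> graded_completion V) \<and>
     (\<forall>\<phi>\<in>graded_dual smul V.
        rational_on_configurations n (\<lambda>zs. pairing \<phi> (F zs)) \<and>
        (\<forall>zs\<in>product_region n. converges_absolutely_to n \<phi> f zs (pairing \<phi> (F zs))))"
    by blast
  from someI_ex[OF this, folded E_fun_def] show ?thesis
    using assms(2,3) by blast
qed

lemma coefficients_determined_by_E_fun: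
  assumes "E_well_defined smul V n f" and "E_well_defined smul V n g"
    and "\<forall>zs\<in>configurations n. E_fun smul V n f zs = E_fun smul V n g zs"
    and "length ks = n"
  shows "f ks = g ks"
proof (rule graded_dual_separates)
  fix \<phi> assume \<phi>: "\<phi> \<in> graded_dual smul V"
  \<comment> \<open>The radii \<open>n, ..., 2, 1\<close> strictly decrease and are positive, so the
    whole torus lies in both \<open>product_region n\<close> and
    \<open>configurations n\<close>.\<close>
  define \<rho>s where "\<rho>s = rev (map (\<lambda>i. real (Suc i)) [0..<n])"
  show "\<phi> (f ks) = \<phi> (g ks)"
  proof (rule converges_absolutely_to_unique[of \<rho>s n \<phi>])
    fix zs assume zs: "map cmod zs = \<rho>s"
    have "length zs = n"
      using arg_cong[OF zs, of length] by (simp add: \<rho>s_def)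
    have "sorted_wrt (>) \<rho>s"
      by (simp add: \<rho>s_def sorted_wrt_rev sorted_wrt_map strict_sorted_iff)
    then have sorted: "sorted_wrt (\<lambda>z z'. cmod z > cmod z') zs"
      by (simp add: sorted_wrt_map flip: zs)
    have "0 \<notin> cmod ` set zs"
      using arg_cong[OF zs, of set] by (auto simp: \<rho>s_def)
    then have "0 \<notin> set zs" by force
    then have "zs \<in> product_region n"
      using \<open>length zs = n\<close> sorted by (simp add: product_region_def)
    moreover have "distinct zs"
      using sorted by (induction zs) auto
    then have "zs \<in> configurations n"
      using \<open>length zs = n\<close> \<open>0 \<notin> set zs\<close> by (simp add: configurations_def)
    ultimately show "\<exists>s. converges_absolutely_to n \<phi> f zs s \<and> converges_absolutely_to n \<phi> g zs s"
      using converges_absolutely_to_E_fun[OF assms(1) \<phi>] converges_absolutely_to_E_fun[OF assms(2) \<phi>] assms(3) by metis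
  qed (use assms(4) in \<open>auto simp: \<rho>s_def\<close>)
qed

end

section \<open>Cocycles that agree on generators\<close>

context homogeneous_basis
begin

text \<open>The two axioms on translation express each coefficient of
  \<open>Y1 u (translation_op Y vac v)\<close> through coefficients of \<open>Y1 u v\<close>
  alone.\<close>

lemma cocycles_agree_translation:
  assumes "cocycle smul Y vac V Y1" and "cocycle smul Y vac V Y1'" and "Y1 u v = Y1' u v"
  shows "Y1 u (translation_op Y vac v) = Y1' u (translation_op Y vac v)"
proof -
  interpret c: cocycle smul Y vac V Y1 by (rule assms)
  interpret c': cocycle smul Y vac V Y1' by (rule assms)
  have "fls_nth (Y1 u (translation_op Y vac v)) k = fls_nth (Y1' u (translation_op Y vac v)) k" for k
    using c.D_commutator[of u v k] c'.D_commutator[of u v k]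
      c.D_derivative[of u v k] c'.D_derivative[of u v k] assms(3)
    by (metis diff_eq_eq add_diff_cancel_left')
  then show ?thesis by (rule fls_eqI)
qed

lemma cocycles_agree_mode:
  assumes "cocycle smul Y vac V Y1" and "cocycle smul Y vac V Y1'"
    and u1: "\<And>v. Y1 u1 v = Y1' u1 v" and u2: "\<And>v. Y1 u2 v = Y1' u2 v"
  shows "Y1 (mode Y u1 n u2) v = Y1' (mode Y u1 n u2) v"
proof -
  interpret c: cocycle smul Y vac V Y1 by (rule assms)
  interpret c': cocycle smul Y vac V Y1' by (rule assms)
  let ?it = "\<lambda>Z ks. fls_nth (Z (fls_nth (Y u1 u2) (ks ! 0)) v) (ks ! 1)
    + fls_nth (Y (fls_nth (Z u1 u2) (ks ! 0)) v) (ks ! 1)"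
  have "fls_nth (Y1 (mode Y u1 n u2) v) k = fls_nth (Y1' (mode Y u1 n u2) v) k" for k
  proof -
    \<comment> \<open>The exponent \<open>- n - 1\<close> of the difference variable selects
      \<open>mode Y u1 n u2\<close> in the first summand. The second summand contains only
      \<open>Z u1 u2\<close>, where the cocycles agree by \<open>u1\<close>, and cancels at the
      end.\<close>
    have "?it Y1 [- n - 1, k] = ?it Y1' [- n - 1, k]"
    proof (rule graded_dual_separates)
      fix \<phi> assume \<phi>: "\<phi> \<in> graded_dual smul V"
      obtain R where R: "rational_on_configurations 2 R"
        "\<And>z1 z2. cmod z1 > cmod z2 \<Longrightarrow> cmod z2 > 0 \<Longrightarrow> converges_absolutely_to 2 \<phi>
              (\<lambda>ks. fls_nth (Y1 u1 (fls_nth (Y u2 v) (ks ! 1))) (ks ! 0)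
                  + fls_nth (Y u1 (fls_nth (Y1 u2 v) (ks ! 1))) (ks ! 0))
              [z1, z2] (R [z1, z2])"
        "\<And>z1 z2. cmod z2 > cmod (z1 - z2) \<Longrightarrow> cmod (z1 - z2) > 0 \<Longrightarrow>
            converges_absolutely_to 2 \<phi> (?it Y1) [z1 - z2, z2] (R [z1, z2])"
        using c.cocycle_duality[OF \<phi>, of u1 u2 v] by blast
      obtain R' where R': "rational_on_configurations 2 R'"
        "\<And>z1 z2. cmod z1 > cmod z2 \<Longrightarrow> cmod z2 > 0 \<Longrightarrow> converges_absolutely_to 2 \<phi>
              (\<lambda>ks. fls_nth (Y1' u1 (fls_nth (Y u2 v) (ks ! 1))) (ks ! 0)
                  + fls_nth (Y u1 (fls_nth (Y1' u2 v) (ks ! 1))) (ks ! 0))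
              [z1, z2] (R' [z1, z2])"
        "\<And>z1 z2. cmod z2 > cmod (z1 - z2) \<Longrightarrow> cmod (z1 - z2) > 0 \<Longrightarrow>
            converges_absolutely_to 2 \<phi> (?it Y1') [z1 - z2, z2] (R' [z1, z2])"
        using c'.cocycle_duality[OF \<phi>, of u1 u2 v] by blast
      have eq: "R [z1, z2] = R' [z1, z2]" if "cmod z1 > cmod z2" "cmod z2 > 0" for z1 z2
        using R(2)[OF that] R'(2)[OF that] u1 u2
        unfolding converges_absolutely_to_iff by (auto dest: has_sum_unique)
      \<comment> \<open>Radii 1 for the difference and 2 for the second variable give a torus in the
        iterate region. There \<open>w + z\<close> need not be longer than \<open>z\<close>, so
        equality of \<open>R\<close> and \<open>R'\<close> must first be continued beyond the
        product region; unequal moduli ensure that \<open>w + z\<close> is nonzero.\<close>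
      show "\<phi> (?it Y1 [- n - 1, k]) = \<phi> (?it Y1' [- n - 1, k])"
      proof (rule converges_absolutely_to_unique[of "[1, 2]" 2 \<phi>])
        fix zs :: "complex list"
        assume "map cmod zs = [1, 2]"
        then obtain w z where zs: "zs = [w, z]" "cmod w = 1" "cmod z = 2"
          by (auto simp: map_eq_Cons_conv)
        have conf: "[w + z, z] \<in> configurations 2"
          using zs by (auto simp: configurations_def add_eq_0_iff)
        have "R [w + z, z] = R' [w + z, z]"
          by (rule rational_on_configurations_2_eqI[OF R(1) R'(1) _ conf]) (rule eq)
        then show "\<exists>s. converges_absolutely_to 2 \<phi> (?it Y1) zs s
            \<and> converges_absolutely_to 2 \<phi> (?it Y1') zs s"
          using R(3)[of "w + z" z] R'(3)[of "w + z" z] zs by auto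
      qed auto
    qed
    then show ?thesis using u1 by (simp add: mode_def)
  qed
  then show ?thesis by (rule fls_eqI)
qed

end

section \<open>Words in the generators: weights, finiteness and reduction to products of
  modes\<close>

lemma mode_product_eq_product_coeff:
  "foldr (\<lambda>(s, n) v. mode Y s n v) ps x = product_coeff Y (map fst ps) x (map (\<lambda>p. - snd p - 1) ps)"
  by (induction ps) (auto simp: product_coeff_def mode_def)

lemma (in grading_restricted_vertex_algebra) word_vector_weight:
  assumes "\<And>i. i \<in> fst ` set w \<Longrightarrow> a i \<in> V (k i)"
  shows "word_vector Y vac a w \<in> V (\<Sum>(i, m)\<leftarrow>w. k i + int m - 1)"
  using assms
proof (induction w)
  case Nil
  then show ?case by (simp add: word_vector_def vac_weight_zero)
next
  case (Cons p w)
  obtain i m where p: "p = (i, m)" by (cases p)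
  have "word_vector Y vac a w \<in> V (\<Sum>(i, m)\<leftarrow>w. k i + int m - 1)" and "a i \<in> V (k i)"
    using Cons p by auto
  from weight_mode[OF this(2,1), of "- int m"] show ?case
    by (simp add: p word_vector_def algebra_simps)
qed

text \<open>With positive generator weights a letter \<open>(i, m)\<close> contributes at least
  \<open>m\<close>, hence at least 1. So the total weight bounds both the length of the word and its
  mode indices.\<close>

lemma finite_ordered_words_of_weight:
  assumes "\<And>i. i \<in> {1..r} \<Longrightarrow> k i > (0 :: int)"
  shows "finite {w. ordered_word r w \<and> (\<Sum>(i, m)\<leftarrow>w. k i + int m - 1) = n}"
proof (rule finite_subset)
  let ?L = "{w. set w \<subseteq> {1..r} \<times> {1..nat n} \<and> length w \<le> nat n}"
  show "finite ?L" by (rule finite_lists_length_le) auto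
  have bound: "int (length w) \<le> (\<Sum>(i, m)\<leftarrow>w. k i + int m - 1) \<and>
      (\<forall>(i, m)\<in>set w. int m \<le> (\<Sum>(i, m)\<leftarrow>w. k i + int m - 1))"
    if "\<forall>(i, m)\<in>set w. i \<in> {1..r} \<and> m \<ge> 1" for w
    using that
  proof (induction w)
    case (Cons p w)
    then have IH: "int (length w) \<le> (\<Sum>(i, m)\<leftarrow>w. k i + int m - 1)"
      "\<forall>(i, m)\<in>set w. int m \<le> (\<Sum>(i, m)\<leftarrow>w. k i + int m - 1)" by auto
    obtain i m where p: "p = (i, m)" by (cases p)
    with Cons.prems have "k i \<ge> 1" "int m \<ge> 1" using assms[of i] by auto
    with IH p show ?case by (fastforce split: prod.splits)
  qed simp
  show "{w. ordered_word r w \<and> (\<Sum>(i, m)\<leftarrow>w. k i + int m - 1) = n} \<subseteq> ?L"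
  proof
    fix w assume "w \<in> {w. ordered_word r w \<and> (\<Sum>(i, m)\<leftarrow>w. k i + int m - 1) = n}"
    then have w: "ordered_word r w" "(\<Sum>(i, m)\<leftarrow>w. k i + int m - 1) = n" by auto
    have *: "\<forall>(i, m)\<in>set w. i \<in> {1..r} \<and> m \<ge> 1"
      using w(1) by (simp add: ordered_word_def)
    show "w \<in> ?L"
      using bound[OF *] * unfolding w(2) by (fastforce simp: le_nat_iff)
  qed
qed

lemma freely_generates_homogeneous_basis:
  assumes "grading_restricted_vertex_algebra smul Y vac V"
    and pos: "\<forall>i\<in>{1..r}. \<exists>k>0. a i \<in> V k"
    and free: "freely_generates smul Y vac a r"
  obtains wt where
    "homogeneous_basis smul Y vac V (word_vector Y vac a ` {w. ordered_word r w}) wt"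
proof -
  interpret grading_restricted_vertex_algebra smul Y vac V by (rule assms)
  let ?W = "{w. ordered_word r w}" and ?v = "word_vector Y vac a"
  obtain k where k: "\<And>i. i \<in> {1..r} \<Longrightarrow> k i > 0" "\<And>i. i \<in> {1..r} \<Longrightarrow> a i \<in> V (k i)"
    using pos by metis
  define ww where "ww w = (\<Sum>(i, m)\<leftarrow>w. k i + int m - 1)" for w :: "(nat \<times> nat) list"
  have inj: "inj_on ?v ?W"
    using free by (simp add: freely_generates_def)
  \<comment> \<open>Injectivity of the word map lets the weight of a basis vector be read off from
    its unique ordered word.\<close>
  have "homogeneous_basis smul Y vac V (?v ` ?W) (\<lambda>b. ww (the_inv_into ?W ?v b))"
  proof unfold_locales
    show "independent (?v ` ?W)" "span (?v ` ?W) = UNIV"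
      using free by (simp_all add: freely_generates_def)
    show "b \<in> V (ww (the_inv_into ?W ?v b))" if "b \<in> ?v ` ?W" for b
    proof -
      obtain w where w: "ordered_word r w" "b = ?v w" using \<open>b \<in> ?v ` ?W\<close> by blast
      have "?v w \<in> V (ww w)"
        unfolding ww_def using w(1) k(2) by (intro word_vector_weight) (auto simp: ordered_word_def)
      then show ?thesis using w inj by (simp add: the_inv_into_f_f)
    qed
    have "{b \<in> ?v ` ?W. ww (the_inv_into ?W ?v b) = n} \<subseteq> ?v ` {w. ordered_word r w \<and> ww w = n}" for n
      using inj by (auto simp: the_inv_into_f_f)
    then show "finite {b \<in> ?v ` ?W. ww (the_inv_into ?W ?v b) = n}" for n
      using finite_ordered_words_of_weight[OF k(1)] unfolding ww_def
      by (meson finite_imageI finite_subset)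
  qed
  then show ?thesis by (rule that)
qed

text \<open>The hypothesis on products covers a last letter of mode \<open>-1\<close>, which creates
  the generator itself; lower last modes come from translation. The prefix modes range over all
  integers because moving translation outwards lowers them.\<close>

lemma (in vertex_algebra) word_vector_mem:
  assumes "subspace K" and "\<And>v. v \<in> K \<Longrightarrow> translation_op Y vac v \<in> K" and "vac \<in> K"
    and prod: "\<And>ps t. fst ` set ps \<subseteq> S \<Longrightarrow> t \<in> S \<Longrightarrow> foldr (\<lambda>(s, n) v. mode Y s n v) ps t \<in> K"
    and w: "\<And>i m. (i, m) \<in> set w \<Longrightarrow> a i \<in> S \<and> m \<ge> 1"
  shows "word_vector Y vac a w \<in> K"
proof (cases w rule: rev_cases)
  case Nil
  then show ?thesis using assms(3) by (simp add: word_vector_def)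
next
  case (snoc w' p)
  let ?op = "foldr (\<lambda>(s, n) v. mode Y s n v)"
  obtain i m where p: "p = (i, m)" by (cases p)
  have "a i \<in> S" "m \<ge> 1" using w snoc p by auto
  \<comment> \<open>Induction on the last mode, for all prefixes at once, since
    \<open>mode_product_translation\<close> requires membership for every prefix before translation
    is inserted.\<close>
  from \<open>m \<ge> 1\<close> have "?op ps (mode Y (a i) (- int m) vac) \<in> K" if "fst ` set ps \<subseteq> S" for ps
    using that
  proof (induction m arbitrary: ps rule: dec_induct)
    case base
    then show ?case using prod[OF _ \<open>a i \<in> S\<close>] by (simp add: mode_creation)
  next
    case (step m)
    have "?op ps (translation_op Y vac (mode Y (a i) (- int m) vac)) \<in> K"
      using step by (intro mode_product_translation[OF assms(1,2), where S = S]) auto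
    then have "smul (1 / of_nat m) (?op ps (translation_op Y vac (mode Y (a i) (- int m) vac))) \<in> K"
      by (rule subspace_scale[OF assms(1)])
    then show ?case
      using step(1) by (simp only: mode_vac_Suc module_hom.scale[OF mode_product_hom])
  qed
  from this[of "map (\<lambda>(i, m). (a i, - int m)) w'"]
  have "?op (map (\<lambda>(i, m). (a i, - int m)) w') (mode Y (a i) (- int m) vac) \<in> K"
    using w snoc by force
  then show ?thesis
    by (simp add: snoc p word_vector_def foldr_map o_def case_prod_unfold)
qed

theorem theorem3p7:
  fixes smul :: "complex \<Rightarrow> 'v::ab_group_add \<Rightarrow> 'v"
    and Y Y1 Y1' :: "'v \<Rightarrow> 'v \<Rightarrow> 'v fls"
    and vac :: 'v
    and V :: "int \<Rightarrow> 'v set"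
    and a :: "nat \<Rightarrow> 'v"
    and r :: nat
    and S :: "'v set"
  assumes "grading_restricted_vertex_algebra smul Y vac V"
    and "S = a ` {1..r}"
    and "\<forall>i\<in>{1..r}. \<exists>k>0. a i \<in> V k"
    and "freely_generates smul Y vac a r"
    and "cocycle smul Y vac V Y1"
    and "cocycle smul Y vac V Y1'"
    and "\<forall>s1\<in>S. \<forall>ss. set ss \<subseteq> S \<longrightarrow> (\<forall>t\<in>S.
           E_well_defined smul V (Suc (length ss)) (cocycle_product Y1 Y s1 ss t))"
    and "\<forall>s1\<in>S. \<forall>ss. set ss \<subseteq> S \<longrightarrow> (\<forall>t\<in>S.
           E_well_defined smul V (Suc (length ss)) (cocycle_product Y1' Y s1 ss t))"
    and "\<forall>s1\<in>S. \<forall>ss. set ss \<subseteq> S \<longrightarrow> (\<forall>t\<in>S. \<forall>zs\<in>configurations (Suc (length ss)).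
           E_fun smul V (Suc (length ss)) (cocycle_product Y1 Y s1 ss t) zs
         = E_fun smul V (Suc (length ss)) (cocycle_product Y1' Y s1 ss t) zs)"
  shows "\<forall>w w'. ordered_word r w \<longrightarrow> ordered_word r w' \<longrightarrow>
           Y1 (word_vector Y vac a w) (word_vector Y vac a w')
         = Y1' (word_vector Y vac a w) (word_vector Y vac a w')"
proof -
  let ?B = "word_vector Y vac a ` {w. ordered_word r w}"
  obtain wt where "homogeneous_basis smul Y vac V ?B wt"
    using freely_generates_homogeneous_basis[OF assms(1,3,4)] .
  then interpret homogeneous_basis smul Y vac V ?B wt .
  interpret c: cocycle smul Y vac V Y1 by (rule assms)
  interpret c': cocycle smul Y vac V Y1' by (rule assms)
  have letters: "a i \<in> S \<and> m \<ge> 1" if "ordered_word r w" "(i, m) \<in> set w" for w i m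
    using that assms(2) by (auto simp: ordered_word_def)
  \<comment> \<open>First the first argument is restricted to generators. Showing
    \<open>K = UNIV\<close> frees the second argument entirely, which is what the later induction on
    the first argument needs.\<close>
  define K where "K = {v. \<forall>s\<in>S. Y1 s v = Y1' s v}"
  have hom: "module_hom smul smul (\<lambda>v. fls_nth (Y1 u v) k)"
    "module_hom smul smul (\<lambda>v. fls_nth (Y1' u v) k)" for u k
    using c.Y1_bilinear c'.Y1_bilinear by (simp_all add: bilinear_series_def linear_iff_module_hom)
  have "subspace K"
    unfolding subspace_def K_def
    by (auto simp: fls_eq_iff module_hom.zero[OF hom(1)] module_hom.zero[OF hom(2)]
        module_hom.add[OF hom(1)] module_hom.add[OF hom(2)]
        module_hom.scale[OF hom(1)] module_hom.scale[OF hom(2)])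
  have prod: "foldr (\<lambda>(s, n) v. mode Y s n v) ps t \<in> K" if "fst ` set ps \<subseteq> S" "t \<in> S" for ps t
  proof -
    let ?ss = "map fst ps" and ?ks = "map (\<lambda>p. - snd p - 1) ps"
    have "Y1 s (product_coeff Y ?ss t ?ks) = Y1' s (product_coeff Y ?ss t ?ks)" if "s \<in> S" for s
    proof (rule fls_eqI)
      fix k
      have ss: "set ?ss \<subseteq> S" using \<open>fst ` set ps \<subseteq> S\<close> by simp
      \<comment> \<open>The head \<open>k\<close> is the exponent of the cocycle variable; the tail
        \<open>?ks\<close> translates the mode indices \<open>n\<close> of \<open>ps\<close> into
        exponents \<open>- n - 1\<close>.\<close>
      have "cocycle_product Y1 Y s ?ss t (k # ?ks) = cocycle_product Y1' Y s ?ss t (k # ?ks)"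
      proof (rule coefficients_determined_by_E_fun)
        show "E_well_defined smul V (Suc (length ?ss)) (cocycle_product Y1 Y s ?ss t)"
          and "E_well_defined smul V (Suc (length ?ss)) (cocycle_product Y1' Y s ?ss t)"
          using assms(7,8) \<open>s \<in> S\<close> ss \<open>t \<in> S\<close> by blast+
        show "\<forall>zs\<in>configurations (Suc (length ?ss)).
            E_fun smul V (Suc (length ?ss)) (cocycle_product Y1 Y s ?ss t) zs
          = E_fun smul V (Suc (length ?ss)) (cocycle_product Y1' Y s ?ss t) zs"
          using assms(9) \<open>s \<in> S\<close> ss \<open>t \<in> S\<close> by blast
      qed simp
      then show "fls_nth (Y1 s (product_coeff Y ?ss t ?ks)) k = fls_nth (Y1' s (product_coeff Y ?ss t ?ks)) k"
        by (simp add: cocycle_product_def)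
    qed
    then show ?thesis by (simp add: K_def mode_product_eq_product_coeff)
  qed
  have "?B \<subseteq> K"
  proof clarify
    fix w assume "ordered_word r w"
    show "word_vector Y vac a w \<in> K"
    proof (rule word_vector_mem[where S = S, OF \<open>subspace K\<close>])
      show "translation_op Y vac v \<in> K" if "v \<in> K" for v
        using that cocycles_agree_translation[OF assms(5,6)] by (simp add: K_def)
      show "vac \<in> K" by (simp add: K_def c.Y1_vac_right c'.Y1_vac_right)
    qed (use prod letters \<open>ordered_word r w\<close> in blast)+
  qed
  then have "K = UNIV"
    using span_minimal[OF _ \<open>subspace K\<close>] span_basis by blast
  then have gen: "Y1 s v = Y1' s v" if "s \<in> S" for s v
    using that by (auto simp: K_def)
  \<comment> \<open>The vector \<open>v\<close> stays arbitrary in the induction because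
    \<open>cocycles_agree_mode\<close> asks for agreement of both factors on all vectors. The empty
    word is settled by the vanishing of cocycles on \<open>vac\<close>.\<close>
  have "Y1 (word_vector Y vac a w) v = Y1' (word_vector Y vac a w) v"
    if "\<And>i m. (i, m) \<in> set w \<Longrightarrow> a i \<in> S" for w v
    using that
  proof (induction w arbitrary: v)
    case Nil
    then show ?case by (simp add: word_vector_def c.Y1_vac_left c'.Y1_vac_left)
  next
    case (Cons p w)
    obtain i m where p: "p = (i, m)" by (cases p)
    have "Y1 (mode Y (a i) (- int m) (word_vector Y vac a w)) v
        = Y1' (mode Y (a i) (- int m) (word_vector Y vac a w)) v"
    proof (rule cocycles_agree_mode[OF assms(5,6)])
      show "Y1 (a i) v = Y1' (a i) v" for v
        using Cons.prems p by (intro gen) auto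
      show "Y1 (word_vector Y vac a w) v = Y1' (word_vector Y vac a w) v" for v
        using Cons.prems by (intro Cons.IH) auto
    qed
    then show ?case by (simp add: p word_vector_def)
  qed
  then show ?thesis using letters by blast
qed

end
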